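(* Let $G$ be a group and $X$ a subset of $G$. Then the following two statements are equivalent. (i) The subset $X$ is amenable with respect to $G$. (ii) For every ring $R$, the ring $T_G(X,R)$ has UGN if and only if $R$ has UGN.
   Context: Rings are unital; "module" means right module. A ring $S$ has unbounded generating number (UGN) if, for every positive integer $n$, there is no $S$-module epimorphism $S^n\to S^{n+1}$. A subset $X$ of a group $G$ is amenable with respect to $G$ if there is a function $\mu:\mathcal P(G)\to[0,\infty]$ such that $\mu(A\cup B)=\mu(A)+\mu(B)$ for all disjoint $A,B\subseteq G$, $\mu(gA)=\mu(A)$ for all $A\subseteq G$ and $g\in G$, and $\mu(X)=1$. For a ring $R$, a group $G$ and a nonempty subset $X\subseteq G$, the translation ring $T_G(X,R)$ is the ring of all $X\times X$ matrices $M$ over $R$ (functions $M:X\times X\to R$) for which there is a finite set $K\subseteq G$ such that $M(x,y)=0$ whenever $y\notin Kx$, with entrywise addition and the product $(MN)(x,y)=\sum_{z\in X}M(x,z)N(z,y)$ (a sum with only finitely many nonzero terms). $T_G(\emptyset,R)$ is defined to be the zero ring. *)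

theory Defs
  imports "HOL-Algebra.Module" "HOL-Algebra.Coset" "HOL-Library.Extended_Nonnegative_Real"
begin

text \<open>
  \<open>HOL-Algebra.Module\<close> only has modules over commutative rings, so right modules over arbitrary
  unital rings are introduced here. The module record of the library is reused;
  \<open>s \<odot>\<^bsub>M\<^esub> x\<close> stands for \<open>x \<cdot> s\<close>, and the fields \<open>mult\<close>, \<open>one\<close> play no role.
\<close>

locale right_module = S?: ring S + M?: abelian_group M
  for S :: "('s, 'm) ring_scheme" (structure)
    and M :: "('s, 'a, 'n) module_scheme" (structure) +
  assumes rsmult_closed: "\<lbrakk>s \<in> carrier S; x \<in> carrier M\<rbrakk> \<Longrightarrow> s \<odot>\<^bsub>M\<^esub> x \<in> carrier M"
    and rsmult_add_scalar: "\<lbrakk>s \<in> carrier S; t \<in> carrier S; x \<in> carrier M\<rbrakk>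
      \<Longrightarrow> (s \<oplus>\<^bsub>S\<^esub> t) \<odot>\<^bsub>M\<^esub> x = s \<odot>\<^bsub>M\<^esub> x \<oplus>\<^bsub>M\<^esub> t \<odot>\<^bsub>M\<^esub> x"
    and rsmult_add: "\<lbrakk>s \<in> carrier S; x \<in> carrier M; y \<in> carrier M\<rbrakk>
      \<Longrightarrow> s \<odot>\<^bsub>M\<^esub> (x \<oplus>\<^bsub>M\<^esub> y) = s \<odot>\<^bsub>M\<^esub> x \<oplus>\<^bsub>M\<^esub> s \<odot>\<^bsub>M\<^esub> y"
    and rsmult_assoc: "\<lbrakk>s \<in> carrier S; t \<in> carrier S; x \<in> carrier M\<rbrakk>
      \<Longrightarrow> (s \<otimes>\<^bsub>S\<^esub> t) \<odot>\<^bsub>M\<^esub> x = t \<odot>\<^bsub>M\<^esub> (s \<odot>\<^bsub>M\<^esub> x)"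
    and rsmult_one: "x \<in> carrier M \<Longrightarrow> \<one>\<^bsub>S\<^esub> \<odot>\<^bsub>M\<^esub> x = x"

definition right_module_hom ::
  "('s, 'm) ring_scheme \<Rightarrow> ('s, 'a, 'n) module_scheme \<Rightarrow> ('s, 'b, 'k) module_scheme \<Rightarrow> ('a \<Rightarrow> 'b) set"
  where "right_module_hom S M N =
    {f \<in> carrier M \<rightarrow> carrier N.
       (\<forall>x\<in>carrier M. \<forall>y\<in>carrier M. f (x \<oplus>\<^bsub>M\<^esub> y) = f x \<oplus>\<^bsub>N\<^esub> f y) \<and>
       (\<forall>s\<in>carrier S. \<forall>x\<in>carrier M. f (s \<odot>\<^bsub>M\<^esub> x) = s \<odot>\<^bsub>N\<^esub> f x)}"

text \<open>In a category of modules the epimorphisms are precisely the surjective homomorphisms.\<close>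

definition right_module_epi ::
  "('s, 'm) ring_scheme \<Rightarrow> ('s, 'a, 'n) module_scheme \<Rightarrow> ('s, 'b, 'k) module_scheme \<Rightarrow> ('a \<Rightarrow> 'b) set"
  where "right_module_epi S M N = {f \<in> right_module_hom S M N. f ` carrier M = carrier N}"

definition free_right_module ::
  "('s, 'm) ring_scheme \<Rightarrow> nat \<Rightarrow> ('s, nat \<Rightarrow> 's) module"
  where "free_right_module S n =
    \<lparr>carrier = {..<n} \<rightarrow>\<^sub>E carrier S,
     mult = undefined,
     one = undefined,
     zero = (\<lambda>i\<in>{..<n}. \<zero>\<^bsub>S\<^esub>),
     add = (\<lambda>v w. \<lambda>i\<in>{..<n}. v i \<oplus>\<^bsub>S\<^esub> w i),
     smult = (\<lambda>s v. \<lambda>i\<in>{..<n}. v i \<otimes>\<^bsub>S\<^esub> s)\<rparr>"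

definition UGN :: "('s, 'm) ring_scheme \<Rightarrow> bool"
  where "UGN S \<longleftrightarrow>
    (\<forall>n>0. \<not> (\<exists>f. f \<in> right_module_epi S (free_right_module S n) (free_right_module S (n + 1))))"

definition amenable_wrt :: "('g, 'm) monoid_scheme \<Rightarrow> 'g set \<Rightarrow> bool"
  where "amenable_wrt G Y \<longleftrightarrow>
    (\<exists>\<mu> :: 'g set \<Rightarrow> ennreal.
       (\<forall>A B. A \<subseteq> carrier G \<longrightarrow> B \<subseteq> carrier G \<longrightarrow> A \<inter> B = {} \<longrightarrow> \<mu> (A \<union> B) = \<mu> A + \<mu> B) \<and>
       (\<forall>A g. A \<subseteq> carrier G \<longrightarrow> g \<in> carrier G \<longrightarrow> \<mu> (g <#\<^bsub>G\<^esub> A) = \<mu> A) \<and>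
       \<mu> Y = 1)"

definition translation_matrices ::
  "('g, 'm) monoid_scheme \<Rightarrow> 'g set \<Rightarrow> ('r, 'n) ring_scheme \<Rightarrow> ('g \<times> 'g \<Rightarrow> 'r) set"
  where "translation_matrices G Y R =
    {M \<in> Y \<times> Y \<rightarrow>\<^sub>E carrier R.
       \<exists>K. finite K \<and> K \<subseteq> carrier G \<and> (\<forall>x\<in>Y. \<forall>y\<in>Y. y \<notin> K #>\<^bsub>G\<^esub> x \<longrightarrow> M (x, y) = \<zero>\<^bsub>R\<^esub>)}"

text \<open>
  A \<open>Y \<times> Y\<close> matrix is a function on pairs that is \<open>undefined\<close> outside \<open>Y \<times> Y\<close>.
  The index set of the sum in the product is cut down to the nonzero terms because \<open>finsum\<close>
  over an infinite set is \<open>\<zero>\<close> by convention. For \<open>Y = {}\<close> the carrier below is a singleton,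
  so this is the zero ring.
\<close>

definition translation_ring ::
  "('g, 'm) monoid_scheme \<Rightarrow> 'g set \<Rightarrow> ('r, 'n) ring_scheme \<Rightarrow> ('g \<times> 'g \<Rightarrow> 'r) ring"
  where "translation_ring G Y R =
    \<lparr>carrier = translation_matrices G Y R,
     mult = (\<lambda>M N. \<lambda>(x, y)\<in>Y \<times> Y.
       \<Oplus>\<^bsub>R\<^esub>z\<in>{z \<in> Y. M (x, z) \<otimes>\<^bsub>R\<^esub> N (z, y) \<noteq> \<zero>\<^bsub>R\<^esub>}. M (x, z) \<otimes>\<^bsub>R\<^esub> N (z, y)),
     one = (\<lambda>(x, y)\<in>Y \<times> Y. if x = y then \<one>\<^bsub>R\<^esub> else \<zero>\<^bsub>R\<^esub>),
     zero = (\<lambda>(x, y)\<in>Y \<times> Y. \<zero>\<^bsub>R\<^esub>),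
     add = (\<lambda>M N. \<lambda>(x, y)\<in>Y \<times> Y. M (x, y) \<oplus>\<^bsub>R\<^esub> N (x, y))\<rparr>"

lemma right_module_free:
  assumes "ring S"
  shows "right_module S (free_right_module S n)"
proof -
  interpret S: ring S by fact
  have "abelian_group (free_right_module S n)"
  proof (rule abelian_groupI)
    fix x assume x: "x \<in> carrier (free_right_module S n)"
    show "\<exists>y\<in>carrier (free_right_module S n).
        y \<oplus>\<^bsub>free_right_module S n\<^esub> x = \<zero>\<^bsub>free_right_module S n\<^esub>"
      by (rule bexI[of _ "\<lambda>i\<in>{..<n}. \<ominus>\<^bsub>S\<^esub> x i"])
        (use x in \<open>auto simp: free_right_module_def S.l_neg PiE_iff intro!: restrict_ext\<close>)
  qed (auto simp: free_right_module_def PiE_iff extensional_def S.a_ac fun_eq_iff)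
  moreover have "right_module_axioms S (free_right_module S n)"
    by unfold_locales
      (auto simp: free_right_module_def PiE_iff extensional_def S.r_distr S.l_distr S.m_assoc fun_eq_iff)
  ultimately show ?thesis
    by (simp add: right_module_def assms)
qed

lemma translation_matrices_memI:
  assumes "finite K" "K \<subseteq> carrier G"
    and "\<And>x y. x \<in> Y \<Longrightarrow> y \<in> Y \<Longrightarrow> M (x, y) \<in> carrier R"
    and "M \<in> extensional (Y \<times> Y)"
    and "\<And>x y. x \<in> Y \<Longrightarrow> y \<in> Y \<Longrightarrow> y \<notin> K #>\<^bsub>G\<^esub> x \<Longrightarrow> M (x, y) = \<zero>\<^bsub>R\<^esub>"
  shows "M \<in> translation_matrices G Y R"
proof -
  have "M \<in> Y \<times> Y \<rightarrow>\<^sub>E carrier R"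
    using assms(3,4) by (auto simp: PiE_iff)
  then show ?thesis
    unfolding translation_matrices_def using assms(1,2,5) by (intro CollectI conjI exI[of _ K]) auto
qed

lemma translation_matrices_entry:
  assumes "M \<in> translation_matrices G Y R" "x \<in> Y" "y \<in> Y"
  shows "M (x, y) \<in> carrier R"
  using assms by (auto simp: translation_matrices_def PiE_iff)

lemma translation_matrices_eqI:
  assumes "M \<in> extensional (Y \<times> Y)" "N \<in> extensional (Y \<times> Y)"
    and "\<And>x y. x \<in> Y \<Longrightarrow> y \<in> Y \<Longrightarrow> M (x, y) = N (x, y)"
  shows "M = N"
  by (rule extensionalityI[OF assms(1,2)]) (use assms(3) in auto)

lemma translation_matrices_row_finite:
  assumes "M \<in> translation_matrices G Y R" "x \<in> Y"
  shows "finite {z \<in> Y. M (x, z) \<noteq> \<zero>\<^bsub>R\<^esub>}"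
proof -
  obtain K where K: "finite K" "\<forall>x\<in>Y. \<forall>y\<in>Y. y \<notin> K #>\<^bsub>G\<^esub> x \<longrightarrow> M (x, y) = \<zero>\<^bsub>R\<^esub>"
    using assms(1) unfolding translation_matrices_def by blast
  have "finite (K #>\<^bsub>G\<^esub> x)"
    using K(1) by (simp add: r_coset_def)
  moreover have "{z \<in> Y. M (x, z) \<noteq> \<zero>\<^bsub>R\<^esub>} \<subseteq> K #>\<^bsub>G\<^esub> x"
    using K(2) assms(2) by blast
  ultimately show ?thesis
    by (rule finite_subset[rotated])
qed

lemma translation_mult_entry:
  assumes "ring R" and M: "M \<in> translation_matrices G Y R" and N: "N \<in> translation_matrices G Y R"
    and xy: "x \<in> Y" "y \<in> Y"
    and Z: "finite Z" "Z \<subseteq> Y" "{z \<in> Y. M (x, z) \<noteq> \<zero>\<^bsub>R\<^esub>} \<subseteq> Z"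
  shows "(M \<otimes>\<^bsub>translation_ring G Y R\<^esub> N) (x, y) = (\<Oplus>\<^bsub>R\<^esub>z\<in>Z. M (x, z) \<otimes>\<^bsub>R\<^esub> N (z, y))"
proof -
  interpret R: ring R by fact
  note [simp] = translation_matrices_entry[OF M] translation_matrices_entry[OF N]
  have "(\<Oplus>\<^bsub>R\<^esub>z\<in>{z \<in> Y. M (x, z) \<otimes>\<^bsub>R\<^esub> N (z, y) \<noteq> \<zero>\<^bsub>R\<^esub>}. M (x, z) \<otimes>\<^bsub>R\<^esub> N (z, y))
      = (\<Oplus>\<^bsub>R\<^esub>z\<in>Z. M (x, z) \<otimes>\<^bsub>R\<^esub> N (z, y))"
  proof (rule R.add.finprod_mono_neutral_cong_left)
    show "{z \<in> Y. M (x, z) \<otimes>\<^bsub>R\<^esub> N (z, y) \<noteq> \<zero>\<^bsub>R\<^esub>} \<subseteq> Z"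
    proof
      fix z assume z: "z \<in> {z \<in> Y. M (x, z) \<otimes>\<^bsub>R\<^esub> N (z, y) \<noteq> \<zero>\<^bsub>R\<^esub>}"
      then have "M (x, z) \<noteq> \<zero>\<^bsub>R\<^esub>" using xy by auto
      with z show "z \<in> Z" using Z(3) by blast
    qed
  qed (use Z(1,2) xy in \<open>auto simp: subset_iff\<close>)
  then show ?thesis
    using xy by (simp add: translation_ring_def)
qed

lemma translation_mult_closed:
  assumes "group G" "Y \<subseteq> carrier G" "ring R"
    and M: "M \<in> translation_matrices G Y R" and N: "N \<in> translation_matrices G Y R"
  shows "M \<otimes>\<^bsub>translation_ring G Y R\<^esub> N \<in> translation_matrices G Y R"
proof -
  interpret R: ring R by fact
  interpret G: group G by fact
  obtain K where K: "finite K" "K \<subseteq> carrier G"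
    "\<And>x y. x \<in> Y \<Longrightarrow> y \<in> Y \<Longrightarrow> y \<notin> K #>\<^bsub>G\<^esub> x \<Longrightarrow> M (x, y) = \<zero>\<^bsub>R\<^esub>"
    using M by (auto simp: translation_matrices_def)
  obtain L where L: "finite L" "L \<subseteq> carrier G"
    "\<And>x y. x \<in> Y \<Longrightarrow> y \<in> Y \<Longrightarrow> y \<notin> L #>\<^bsub>G\<^esub> x \<Longrightarrow> N (x, y) = \<zero>\<^bsub>R\<^esub>"
    using N by (auto simp: translation_matrices_def)
  note entry = translation_matrices_entry[OF M] translation_matrices_entry[OF N]
  show ?thesis
  proof (rule translation_matrices_memI)
    show "finite (L <#>\<^bsub>G\<^esub> K)"
      using K L by (simp add: set_mult_def)
    show "L <#>\<^bsub>G\<^esub> K \<subseteq> carrier G"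
      using K L by (simp add: G.set_mult_closed)
    show "M \<otimes>\<^bsub>translation_ring G Y R\<^esub> N \<in> extensional (Y \<times> Y)"
      by (simp add: translation_ring_def)
    fix x y assume xy: "x \<in> Y" "y \<in> Y"
    let ?Z = "{z \<in> Y. M (x, z) \<noteq> \<zero>\<^bsub>R\<^esub>}"
    have eq: "(M \<otimes>\<^bsub>translation_ring G Y R\<^esub> N) (x, y) = (\<Oplus>\<^bsub>R\<^esub>z\<in>?Z. M (x, z) \<otimes>\<^bsub>R\<^esub> N (z, y))"
      by (rule translation_mult_entry[OF assms(3) M N xy translation_matrices_row_finite[OF M xy(1)]]) auto
    show "(M \<otimes>\<^bsub>translation_ring G Y R\<^esub> N) (x, y) \<in> carrier R"
      unfolding eq by (rule R.finsum_closed) (use xy entry in auto)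
    assume y: "y \<notin> (L <#>\<^bsub>G\<^esub> K) #>\<^bsub>G\<^esub> x"
    have "N (z, y) = \<zero>\<^bsub>R\<^esub>" if z: "z \<in> ?Z" for z
    proof (rule L(3))
      show "y \<notin> L #>\<^bsub>G\<^esub> z"
      proof
        assume "y \<in> L #>\<^bsub>G\<^esub> z"
        then obtain l where l: "l \<in> L" "y = l \<otimes>\<^bsub>G\<^esub> z" by (auto simp: r_coset_def)
        have "z \<in> K #>\<^bsub>G\<^esub> x" using K(3)[of x z] z xy by auto
        then obtain k where k: "k \<in> K" "z = k \<otimes>\<^bsub>G\<^esub> x" by (auto simp: r_coset_def)
        have "y = (l \<otimes>\<^bsub>G\<^esub> k) \<otimes>\<^bsub>G\<^esub> x"
          using l k K(2) L(2) xy assms(2) by (simp add: subset_iff G.m_assoc)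
        then show False using y l(1) k(1) by (auto simp: r_coset_def set_mult_def)
      qed
    qed (use z xy in auto)
    then have "(\<Oplus>\<^bsub>R\<^esub>z\<in>?Z. M (x, z) \<otimes>\<^bsub>R\<^esub> N (z, y)) = (\<Oplus>\<^bsub>R\<^esub>z\<in>?Z. \<zero>\<^bsub>R\<^esub>)"
      by (intro R.finsum_cong') (use xy entry in auto)
    then show "(M \<otimes>\<^bsub>translation_ring G Y R\<^esub> N) (x, y) = \<zero>\<^bsub>R\<^esub>"
      by (simp add: eq)
  qed
qed

lemma (in abelian_monoid) finsum_exchange:
  assumes "finite A" "finite B" "\<And>a b. a \<in> A \<Longrightarrow> b \<in> B \<Longrightarrow> f a b \<in> carrier G"
  shows "(\<Oplus>a\<in>A. \<Oplus>b\<in>B. f a b) = (\<Oplus>b\<in>B. \<Oplus>a\<in>A. f a b)"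
  using assms(1,3)
proof (induction A rule: finite_induct)
  case (insert a A)
  then have closed: "(\<lambda>b. f a b) \<in> B \<rightarrow> carrier G" "(\<lambda>b. \<Oplus>a\<in>A. f a b) \<in> B \<rightarrow> carrier G"
    "(\<lambda>a. \<Oplus>b\<in>B. f a b) \<in> A \<rightarrow> carrier G"
    by (auto intro!: finsum_closed)
  have "(\<Oplus>a\<in>insert a A. \<Oplus>b\<in>B. f a b) = (\<Oplus>b\<in>B. f a b) \<oplus> (\<Oplus>b\<in>B. \<Oplus>a\<in>A. f a b)"
    using insert closed by (simp add: finsum_insert finsum_closed)
  also have "\<dots> = (\<Oplus>b\<in>B. f a b \<oplus> (\<Oplus>a\<in>A. f a b))"
    using closed by (simp add: finsum_addf)
  also have "\<dots> = (\<Oplus>b\<in>B. \<Oplus>a\<in>insert a A. f a b)"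
    using insert closed by (intro finsum_cong') (auto simp: finsum_insert Pi_iff)
  finally show ?case .
qed simp

lemma translation_mult_assoc:
  assumes "group G" "Y \<subseteq> carrier G" "ring R"
    and L: "L \<in> translation_matrices G Y R" and M: "M \<in> translation_matrices G Y R"
    and N: "N \<in> translation_matrices G Y R"
  defines "T \<equiv> translation_ring G Y R"
  shows "(L \<otimes>\<^bsub>T\<^esub> M) \<otimes>\<^bsub>T\<^esub> N = L \<otimes>\<^bsub>T\<^esub> (M \<otimes>\<^bsub>T\<^esub> N)"
proof (rule translation_matrices_eqI[where Y = Y])
  interpret R: ring R by fact
  note LM = translation_mult_closed[OF assms(1-3) L M, folded T_def]
  note MN = translation_mult_closed[OF assms(1-3) M N, folded T_def]
  note eL = translation_matrices_entry[OF L]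
  note eM = translation_matrices_entry[OF M]
  note eN = translation_matrices_entry[OF N]
  note row = translation_mult_entry[where G = G and Y = Y, OF assms(3), folded T_def]
  fix x y assume xy: "x \<in> Y" "y \<in> Y"
  define W where "W = {w \<in> Y. L (x, w) \<noteq> \<zero>\<^bsub>R\<^esub>}"
  define Z where "Z = {z \<in> Y. (L \<otimes>\<^bsub>T\<^esub> M) (x, z) \<noteq> \<zero>\<^bsub>R\<^esub>} \<union> (\<Union>w\<in>W. {z \<in> Y. M (w, z) \<noteq> \<zero>\<^bsub>R\<^esub>})"
  have W: "finite W" "W \<subseteq> Y"
    using translation_matrices_row_finite[OF L xy(1)] by (auto simp: W_def)
  have Z: "finite Z" "Z \<subseteq> Y"
    using W translation_matrices_row_finite[OF LM xy(1)] translation_matrices_row_finite[OF M]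
    by (auto simp: Z_def)
  have "((L \<otimes>\<^bsub>T\<^esub> M) \<otimes>\<^bsub>T\<^esub> N) (x, y) = (\<Oplus>\<^bsub>R\<^esub>z\<in>Z. (L \<otimes>\<^bsub>T\<^esub> M) (x, z) \<otimes>\<^bsub>R\<^esub> N (z, y))"
    by (rule row[OF LM N xy Z]) (auto simp: Z_def)
  also have "\<dots> = (\<Oplus>\<^bsub>R\<^esub>z\<in>Z. \<Oplus>\<^bsub>R\<^esub>w\<in>W. L (x, w) \<otimes>\<^bsub>R\<^esub> (M (w, z) \<otimes>\<^bsub>R\<^esub> N (z, y)))"
  proof (rule R.finsum_cong')
    fix z assume z: "z \<in> Z"
    then have zX: "z \<in> Y" using Z by auto
    have "(L \<otimes>\<^bsub>T\<^esub> M) (x, z) = (\<Oplus>\<^bsub>R\<^esub>w\<in>W. L (x, w) \<otimes>\<^bsub>R\<^esub> M (w, z))"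
      by (rule row[OF L M xy(1) zX W]) (auto simp: W_def)
    then have "(L \<otimes>\<^bsub>T\<^esub> M) (x, z) \<otimes>\<^bsub>R\<^esub> N (z, y)
        = (\<Oplus>\<^bsub>R\<^esub>w\<in>W. (L (x, w) \<otimes>\<^bsub>R\<^esub> M (w, z)) \<otimes>\<^bsub>R\<^esub> N (z, y))"
      using W(2) by (simp add: R.finsum_ldistr[OF W(1)] eL eM eN xy zX Pi_iff subset_iff)
    also have "\<dots> = (\<Oplus>\<^bsub>R\<^esub>w\<in>W. L (x, w) \<otimes>\<^bsub>R\<^esub> (M (w, z) \<otimes>\<^bsub>R\<^esub> N (z, y)))"
      using W(2) by (intro R.finsum_cong') (auto simp: R.m_assoc eL eM eN xy zX subset_iff)
    finally show "(L \<otimes>\<^bsub>T\<^esub> M) (x, z) \<otimes>\<^bsub>R\<^esub> N (z, y)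
        = (\<Oplus>\<^bsub>R\<^esub>w\<in>W. L (x, w) \<otimes>\<^bsub>R\<^esub> (M (w, z) \<otimes>\<^bsub>R\<^esub> N (z, y)))" .
  qed (use W(2) Z(2) in \<open>auto intro!: R.finsum_closed simp: eL eM eN xy subset_iff\<close>)
  also have "\<dots> = (\<Oplus>\<^bsub>R\<^esub>w\<in>W. \<Oplus>\<^bsub>R\<^esub>z\<in>Z. L (x, w) \<otimes>\<^bsub>R\<^esub> (M (w, z) \<otimes>\<^bsub>R\<^esub> N (z, y)))"
    by (rule R.finsum_exchange)
      (use W Z in \<open>auto simp: eL eM eN xy subset_iff\<close>)
  also have "\<dots> = (\<Oplus>\<^bsub>R\<^esub>w\<in>W. L (x, w) \<otimes>\<^bsub>R\<^esub> (M \<otimes>\<^bsub>T\<^esub> N) (w, y))"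
  proof (rule R.finsum_cong')
    fix w assume w: "w \<in> W"
    then have wX: "w \<in> Y" using W by auto
    have "(M \<otimes>\<^bsub>T\<^esub> N) (w, y) = (\<Oplus>\<^bsub>R\<^esub>z\<in>Z. M (w, z) \<otimes>\<^bsub>R\<^esub> N (z, y))"
      by (rule row[OF M N wX xy(2) Z]) (use w in \<open>auto simp: Z_def\<close>)
    then show "(\<Oplus>\<^bsub>R\<^esub>z\<in>Z. L (x, w) \<otimes>\<^bsub>R\<^esub> (M (w, z) \<otimes>\<^bsub>R\<^esub> N (z, y))) = L (x, w) \<otimes>\<^bsub>R\<^esub> (M \<otimes>\<^bsub>T\<^esub> N) (w, y)"
      using Z(2) by (simp add: R.finsum_rdistr[OF Z(1)] eL eM eN xy wX Pi_iff subset_iff)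
  qed (use W(2) in \<open>auto simp: eL translation_matrices_entry[OF MN] xy subset_iff\<close>)
  also have "\<dots> = (L \<otimes>\<^bsub>T\<^esub> (M \<otimes>\<^bsub>T\<^esub> N)) (x, y)"
    by (rule row[OF L MN xy W, symmetric]) (auto simp: W_def)
  finally show "((L \<otimes>\<^bsub>T\<^esub> M) \<otimes>\<^bsub>T\<^esub> N) (x, y) = (L \<otimes>\<^bsub>T\<^esub> (M \<otimes>\<^bsub>T\<^esub> N)) (x, y)" .
qed (simp_all add: T_def translation_ring_def)

lemma translation_add_closed:
  assumes "ring R" and M: "M \<in> translation_matrices G Y R" and N: "N \<in> translation_matrices G Y R"
  shows "M \<oplus>\<^bsub>translation_ring G Y R\<^esub> N \<in> translation_matrices G Y R"
proof -
  interpret R: ring R by fact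
  obtain K where K: "finite K" "K \<subseteq> carrier G"
    "\<And>x y. x \<in> Y \<Longrightarrow> y \<in> Y \<Longrightarrow> y \<notin> K #>\<^bsub>G\<^esub> x \<Longrightarrow> M (x, y) = \<zero>\<^bsub>R\<^esub>"
    using M by (auto simp: translation_matrices_def)
  obtain L where L: "finite L" "L \<subseteq> carrier G"
    "\<And>x y. x \<in> Y \<Longrightarrow> y \<in> Y \<Longrightarrow> y \<notin> L #>\<^bsub>G\<^esub> x \<Longrightarrow> N (x, y) = \<zero>\<^bsub>R\<^esub>"
    using N by (auto simp: translation_matrices_def)
  show ?thesis
    by (rule translation_matrices_memI[of "K \<union> L"])
      (use K L in \<open>auto simp: translation_ring_def r_coset_def
        translation_matrices_entry[OF M] translation_matrices_entry[OF N]\<close>)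
qed

lemma ring_translation_ring:
  assumes "group G" "Y \<subseteq> carrier G" "ring R"
  shows "ring (translation_ring G Y R)"
proof -
  interpret R: ring R by fact
  interpret G: group G by fact
  let ?T = "translation_ring G Y R"
  have carrier: "carrier ?T = translation_matrices G Y R"
    by (simp add: translation_ring_def)
  note entry = translation_matrices_entry[where R = R and Y = Y and G = G]
  have ext: "M \<in> extensional (Y \<times> Y)" if "M \<in> translation_matrices G Y R" for M
    using that by (simp add: translation_matrices_def PiE_iff)
  have add_entry: "(M \<oplus>\<^bsub>?T\<^esub> N) (x, y) = M (x, y) \<oplus>\<^bsub>R\<^esub> N (x, y)" if "x \<in> Y" "y \<in> Y" for M N x y
    using that by (simp add: translation_ring_def)
  have zero_entry: "\<zero>\<^bsub>?T\<^esub> (x, y) = \<zero>\<^bsub>R\<^esub>" if "x \<in> Y" "y \<in> Y" for x y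
    using that by (simp add: translation_ring_def)
  have one_entry: "\<one>\<^bsub>?T\<^esub> (x, y) = (if x = y then \<one>\<^bsub>R\<^esub> else \<zero>\<^bsub>R\<^esub>)" if "x \<in> Y" "y \<in> Y" for x y
    using that by (simp add: translation_ring_def)
  have ext_ops: "M \<oplus>\<^bsub>?T\<^esub> N \<in> extensional (Y \<times> Y)" "M \<otimes>\<^bsub>?T\<^esub> N \<in> extensional (Y \<times> Y)"
    "\<zero>\<^bsub>?T\<^esub> \<in> extensional (Y \<times> Y)" "\<one>\<^bsub>?T\<^esub> \<in> extensional (Y \<times> Y)" for M N
    by (simp_all add: translation_ring_def)
  have zero: "\<zero>\<^bsub>?T\<^esub> \<in> translation_matrices G Y R"
    by (rule translation_matrices_memI[of "{}"]) (auto simp: ext_ops zero_entry)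
  have one: "\<one>\<^bsub>?T\<^esub> \<in> translation_matrices G Y R"
    by (rule translation_matrices_memI[of "{\<one>\<^bsub>G\<^esub>}"])
      (use assms(2) in \<open>auto simp: ext_ops one_entry r_coset_def subset_iff\<close>)
  note row = translation_mult_entry[OF assms(3)]
  show ?thesis
  proof (rule ringI)
    show "abelian_group ?T"
    proof (rule abelian_groupI, unfold carrier)
      fix M N assume "M \<in> translation_matrices G Y R" "N \<in> translation_matrices G Y R"
      then show "M \<oplus>\<^bsub>?T\<^esub> N \<in> translation_matrices G Y R"
        by (rule translation_add_closed[OF assms(3)])
    next
      show "\<zero>\<^bsub>?T\<^esub> \<in> translation_matrices G Y R" by (rule zero)
    next
      fix L M N assume "L \<in> translation_matrices G Y R" "M \<in> translation_matrices G Y R"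
        "N \<in> translation_matrices G Y R"
      then show "L \<oplus>\<^bsub>?T\<^esub> M \<oplus>\<^bsub>?T\<^esub> N = L \<oplus>\<^bsub>?T\<^esub> (M \<oplus>\<^bsub>?T\<^esub> N)"
        by (intro translation_matrices_eqI[where Y = Y]) (auto simp: ext_ops add_entry entry R.a_assoc)
    next
      fix M N assume "M \<in> translation_matrices G Y R" "N \<in> translation_matrices G Y R"
      then show "M \<oplus>\<^bsub>?T\<^esub> N = N \<oplus>\<^bsub>?T\<^esub> M"
        by (intro translation_matrices_eqI[where Y = Y]) (auto simp: ext_ops add_entry entry R.a_comm)
    next
      fix M assume "M \<in> translation_matrices G Y R"
      then show "\<zero>\<^bsub>?T\<^esub> \<oplus>\<^bsub>?T\<^esub> M = M"
        by (intro translation_matrices_eqI[where Y = Y]) (auto simp: ext_ops ext add_entry zero_entry entry)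
    next
      fix M assume M: "M \<in> translation_matrices G Y R"
      then obtain K where K: "finite K" "K \<subseteq> carrier G"
        "\<And>x y. x \<in> Y \<Longrightarrow> y \<in> Y \<Longrightarrow> y \<notin> K #>\<^bsub>G\<^esub> x \<Longrightarrow> M (x, y) = \<zero>\<^bsub>R\<^esub>"
        by (auto simp: translation_matrices_def)
      let ?N = "\<lambda>(x, y)\<in>Y \<times> Y. \<ominus>\<^bsub>R\<^esub> M (x, y)"
      have "?N \<in> translation_matrices G Y R"
        by (rule translation_matrices_memI[of K]) (use K in \<open>auto simp: entry[OF M]\<close>)
      moreover have "?N \<oplus>\<^bsub>?T\<^esub> M = \<zero>\<^bsub>?T\<^esub>"
        by (rule translation_matrices_eqI[where Y = Y])
          (auto simp: ext_ops add_entry zero_entry entry[OF M] R.l_neg)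
      ultimately show "\<exists>N\<in>translation_matrices G Y R. N \<oplus>\<^bsub>?T\<^esub> M = \<zero>\<^bsub>?T\<^esub>" by blast
    qed
    show "monoid ?T"
    proof (rule monoidI, unfold carrier)
      fix M N assume "M \<in> translation_matrices G Y R" "N \<in> translation_matrices G Y R"
      then show "M \<otimes>\<^bsub>?T\<^esub> N \<in> translation_matrices G Y R"
        by (rule translation_mult_closed[OF assms])
    next
      show "\<one>\<^bsub>?T\<^esub> \<in> translation_matrices G Y R" by (rule one)
    next
      fix L M N assume "L \<in> translation_matrices G Y R" "M \<in> translation_matrices G Y R"
        "N \<in> translation_matrices G Y R"
      then show "L \<otimes>\<^bsub>?T\<^esub> M \<otimes>\<^bsub>?T\<^esub> N = L \<otimes>\<^bsub>?T\<^esub> (M \<otimes>\<^bsub>?T\<^esub> N)"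
        by (rule translation_mult_assoc[OF assms])
    next
      fix M assume M: "M \<in> translation_matrices G Y R"
      show "\<one>\<^bsub>?T\<^esub> \<otimes>\<^bsub>?T\<^esub> M = M"
      proof (rule translation_matrices_eqI[OF ext_ops(2) ext[OF M]])
        fix x y assume xy: "x \<in> Y" "y \<in> Y"
        have "(\<one>\<^bsub>?T\<^esub> \<otimes>\<^bsub>?T\<^esub> M) (x, y) = (\<Oplus>\<^bsub>R\<^esub>z\<in>{x}. \<one>\<^bsub>?T\<^esub> (x, z) \<otimes>\<^bsub>R\<^esub> M (z, y))"
          by (rule row[OF one M xy]) (use xy in \<open>auto simp: one_entry split: if_splits\<close>)
        then show "(\<one>\<^bsub>?T\<^esub> \<otimes>\<^bsub>?T\<^esub> M) (x, y) = M (x, y)"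
          using xy by (simp add: one_entry entry[OF M])
      qed
      show "M \<otimes>\<^bsub>?T\<^esub> \<one>\<^bsub>?T\<^esub> = M"
      proof (rule translation_matrices_eqI[OF ext_ops(2) ext[OF M]])
        fix x y assume xy: "x \<in> Y" "y \<in> Y"
        let ?Z = "insert y {z \<in> Y. M (x, z) \<noteq> \<zero>\<^bsub>R\<^esub>}"
        have fin: "finite ?Z" using translation_matrices_row_finite[OF M xy(1)] by simp
        have "(M \<otimes>\<^bsub>?T\<^esub> \<one>\<^bsub>?T\<^esub>) (x, y) = (\<Oplus>\<^bsub>R\<^esub>z\<in>?Z. M (x, z) \<otimes>\<^bsub>R\<^esub> \<one>\<^bsub>?T\<^esub> (z, y))"
          by (rule row[OF M one xy fin]) (use xy in auto)
        also have "\<dots> = (\<Oplus>\<^bsub>R\<^esub>z\<in>{y}. M (x, z) \<otimes>\<^bsub>R\<^esub> \<one>\<^bsub>?T\<^esub> (z, y))"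
          by (rule R.add.finprod_mono_neutral_cong_right)
            (use fin xy in \<open>auto simp: one_entry entry[OF M]\<close>)
        also have "\<dots> = M (x, y)"
          using xy by (simp add: one_entry entry[OF M])
        finally show "(M \<otimes>\<^bsub>?T\<^esub> \<one>\<^bsub>?T\<^esub>) (x, y) = M (x, y)" .
      qed
    qed
  next
    fix L M N assume "L \<in> carrier ?T" "M \<in> carrier ?T" "N \<in> carrier ?T"
    then have L: "L \<in> translation_matrices G Y R" and M: "M \<in> translation_matrices G Y R"
      and N: "N \<in> translation_matrices G Y R" by (simp_all add: carrier)
    note LM = translation_add_closed[OF assms(3) L M]
    note e = entry[OF L] entry[OF M] entry[OF N]
    show "(L \<oplus>\<^bsub>?T\<^esub> M) \<otimes>\<^bsub>?T\<^esub> N = L \<otimes>\<^bsub>?T\<^esub> N \<oplus>\<^bsub>?T\<^esub> M \<otimes>\<^bsub>?T\<^esub> N"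
    proof (rule translation_matrices_eqI[OF ext_ops(2) ext_ops(1)])
      fix x y assume xy: "x \<in> Y" "y \<in> Y"
      define Z where "Z = {z \<in> Y. L (x, z) \<noteq> \<zero>\<^bsub>R\<^esub>} \<union> {z \<in> Y. M (x, z) \<noteq> \<zero>\<^bsub>R\<^esub>}"
      have Z: "finite Z" "Z \<subseteq> Y"
        using translation_matrices_row_finite[OF L xy(1)] translation_matrices_row_finite[OF M xy(1)]
        by (auto simp: Z_def)
      have "((L \<oplus>\<^bsub>?T\<^esub> M) \<otimes>\<^bsub>?T\<^esub> N) (x, y) = (\<Oplus>\<^bsub>R\<^esub>z\<in>Z. (L \<oplus>\<^bsub>?T\<^esub> M) (x, z) \<otimes>\<^bsub>R\<^esub> N (z, y))"
        by (rule row[OF LM N xy Z]) (use xy in \<open>auto simp: Z_def add_entry\<close>)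
      also have "\<dots> = (\<Oplus>\<^bsub>R\<^esub>z\<in>Z. L (x, z) \<otimes>\<^bsub>R\<^esub> N (z, y) \<oplus>\<^bsub>R\<^esub> M (x, z) \<otimes>\<^bsub>R\<^esub> N (z, y))"
        using Z xy by (intro R.finsum_cong') (auto simp: add_entry e subset_iff R.l_distr)
      also have "\<dots> = (\<Oplus>\<^bsub>R\<^esub>z\<in>Z. L (x, z) \<otimes>\<^bsub>R\<^esub> N (z, y)) \<oplus>\<^bsub>R\<^esub> (\<Oplus>\<^bsub>R\<^esub>z\<in>Z. M (x, z) \<otimes>\<^bsub>R\<^esub> N (z, y))"
        using Z xy by (intro R.finsum_addf) (auto simp: e subset_iff)
      also have "\<dots> = (L \<otimes>\<^bsub>?T\<^esub> N) (x, y) \<oplus>\<^bsub>R\<^esub> (M \<otimes>\<^bsub>?T\<^esub> N) (x, y)"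
        by (subst (1 2) row[OF _ N xy Z]) (auto simp: Z_def L M)
      finally show "((L \<oplus>\<^bsub>?T\<^esub> M) \<otimes>\<^bsub>?T\<^esub> N) (x, y) = (L \<otimes>\<^bsub>?T\<^esub> N \<oplus>\<^bsub>?T\<^esub> M \<otimes>\<^bsub>?T\<^esub> N) (x, y)"
        using xy by (simp add: add_entry)
    qed
    show "N \<otimes>\<^bsub>?T\<^esub> (L \<oplus>\<^bsub>?T\<^esub> M) = N \<otimes>\<^bsub>?T\<^esub> L \<oplus>\<^bsub>?T\<^esub> N \<otimes>\<^bsub>?T\<^esub> M"
    proof (rule translation_matrices_eqI[OF ext_ops(2) ext_ops(1)])
      fix x y assume xy: "x \<in> Y" "y \<in> Y"
      define Z where "Z = {z \<in> Y. N (x, z) \<noteq> \<zero>\<^bsub>R\<^esub>}"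
      have Z: "finite Z" "Z \<subseteq> Y"
        using translation_matrices_row_finite[OF N xy(1)] by (auto simp: Z_def)
      have "(N \<otimes>\<^bsub>?T\<^esub> (L \<oplus>\<^bsub>?T\<^esub> M)) (x, y) = (\<Oplus>\<^bsub>R\<^esub>z\<in>Z. N (x, z) \<otimes>\<^bsub>R\<^esub> (L \<oplus>\<^bsub>?T\<^esub> M) (z, y))"
        by (rule row[OF N LM xy Z]) (auto simp: Z_def)
      also have "\<dots> = (\<Oplus>\<^bsub>R\<^esub>z\<in>Z. N (x, z) \<otimes>\<^bsub>R\<^esub> L (z, y) \<oplus>\<^bsub>R\<^esub> N (x, z) \<otimes>\<^bsub>R\<^esub> M (z, y))"
        using Z xy by (intro R.finsum_cong') (auto simp: add_entry e subset_iff R.r_distr)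
      also have "\<dots> = (\<Oplus>\<^bsub>R\<^esub>z\<in>Z. N (x, z) \<otimes>\<^bsub>R\<^esub> L (z, y)) \<oplus>\<^bsub>R\<^esub> (\<Oplus>\<^bsub>R\<^esub>z\<in>Z. N (x, z) \<otimes>\<^bsub>R\<^esub> M (z, y))"
        using Z xy by (intro R.finsum_addf) (auto simp: e subset_iff)
      also have "\<dots> = (N \<otimes>\<^bsub>?T\<^esub> L) (x, y) \<oplus>\<^bsub>R\<^esub> (N \<otimes>\<^bsub>?T\<^esub> M) (x, y)"
        by (simp add: row[OF N L xy Z] row[OF N M xy Z] Z_def)
      finally show "(N \<otimes>\<^bsub>?T\<^esub> (L \<oplus>\<^bsub>?T\<^esub> M)) (x, y) = (N \<otimes>\<^bsub>?T\<^esub> L \<oplus>\<^bsub>?T\<^esub> N \<otimes>\<^bsub>?T\<^esub> M) (x, y)"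
        using xy by (simp add: add_entry)
    qed
  qed
qed

end

theory Submission
  imports Defs "HOL-Algebra.RingHom" "HOL-Analysis.Function_Topology"
begin

text \<open>
  Both statements are equivalent to a Folner condition on the subset \<open>Y\<close>: for every finite \<open>K\<close> and
  every \<open>n > 0\<close> there is a finite nonempty \<open>F \<subseteq> Y\<close> with \<open>n |K F \<inter> Y| < (n + 1) |F|\<close>.

  If the Folner condition fails, the marriage theorem turns the reversed inequality into a compression
  (\<open>compression_if_not_folner\<close>): an injection of \<open>n + 1\<close> copies of \<open>Y\<close> into \<open>n\<close> copies of \<open>Y\<close> that moves
  points by finitely many left translations. A compression excludes invariant measures with
  \<open>\<mu> Y = 1\<close> (\<open>not_amenable_if_compression\<close>). Conversely, Folner sets yield an invariant measure by
  compactness (\<open>amenable_if_folner\<close>). So amenability, the Folner condition and the absence of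
  compressions with \<open>n > 0\<close> are the same.

  A ring lacks unbounded generating number if and only if, for some \<open>n > 0\<close>, the identity matrix of
  size \<open>n + 1\<close> factors through size \<open>n\<close>. A compression, read as a 0-1 matrix, is such a factorisation over
  the translation ring of any ring \<open>R\<close> (\<open>not_UGN_translation_if_compression\<close>). In the
  presence of the Folner condition, a factorisation over the translation ring restricts to a finite
  factorisation over \<open>R\<close> (\<open>UGN_translation_if_folner\<close>). A factorisation over \<open>R\<close> always gives one
  over the translation ring, because \<open>R\<close> maps to it by scalar matrices. For the implication from the
  rings to amenability, one ring with unbounded generating number suffices, and the field with
  two elements can be put on any two values of the type of ring elements.
\<close>

section \<open>The marriage theorem for infinite families of finite sets\<close>

text \<open>
  Rado's proof. By Zorn's lemma there is a maximal set \<open>M\<close> of edges whose removal preserves Hall's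
  condition; finiteness of the neighbourhoods makes the union of a chain of such sets another one.
  Once \<open>M\<close> is removed, every vertex has exactly one neighbour: if \<open>i\<close> had two, then removing either
  edge would violate Hall's condition, and the two violations contradict Hall's condition through
  \<open>|P \<union> Q| + |P \<inter> Q| = |P| + |Q|\<close>.
\<close>

lemma infinite_marriage:
  fixes E :: "('i \<times> 'a) set"
  assumes fin: "\<And>i. i \<in> I \<Longrightarrow> finite (E `` {i})"
    and hall: "\<And>J. finite J \<Longrightarrow> J \<subseteq> I \<Longrightarrow> card J \<le> card (E `` J)"
  shows "\<exists>f. inj_on f I \<and> (\<forall>i\<in>I. (i, f i) \<in> E)"
proof -
  \<comment> \<open>the sets of edges that can be removed without destroying Hall's condition\<close>
  define H where "H = {D. \<forall>J. finite J \<longrightarrow> J \<subseteq> I \<longrightarrow> card J \<le> card ((E - D) `` J)}"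
  have finE: "finite (E `` J)" if "finite J" "J \<subseteq> I" for J
  proof -
    have "E `` J = (\<Union>j\<in>J. E `` {j})" by blast
    then show ?thesis using that fin by auto
  qed
  have "\<exists>M\<in>H. \<forall>X\<in>H. M \<subseteq> X \<longrightarrow> X = M"
  proof (rule subset_Zorn_nonempty)
    have "{} \<in> H" using hall by (simp add: H_def)
    then show "H \<noteq> {}" by blast
  next
    fix C assume C: "C \<noteq> {}" "subset.chain H C"
    have "card J \<le> card ((E - \<Union>C) `` J)" if J: "finite J" "J \<subseteq> I" for J
    proof -
      have "E \<inter> (J \<times> UNIV) \<subseteq> J \<times> (E `` J)" by blast
      then have "finite (E \<inter> (J \<times> UNIV) \<inter> \<Union>C)"
        using J finE[OF J] by (meson finite_Int finite_SigmaI finite_subset)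
      then obtain D where D: "D \<in> C" "E \<inter> (J \<times> UNIV) \<inter> \<Union>C \<subseteq> D"
        using finite_subset_Union_chain[of "E \<inter> (J \<times> UNIV) \<inter> \<Union>C" C H] C by blast
      then have "(E - \<Union>C) `` J = (E - D) `` J" by blast
      moreover have "D \<in> H" using C(2) D(1) by (auto simp: subset.chain_def)
      ultimately show ?thesis using J by (simp add: H_def)
    qed
    then show "\<Union>C \<in> H" by (simp add: H_def)
  qed
  then obtain M where M: "M \<in> H" and max: "\<And>X. X \<in> H \<Longrightarrow> M \<subseteq> X \<Longrightarrow> X = M" by blast
  define A where "A = E - M"
  have hallA: "card J \<le> card (A `` J)" if "finite J" "J \<subseteq> I" for J
    using M that by (simp add: H_def A_def)
  have finA: "finite (A `` J)" if "finite J" "J \<subseteq> I" for J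
    by (rule finite_subset[OF _ finE[OF that]]) (auto simp: A_def)
  \<comment> \<open>Maximality: an edge of \<open>A\<close> at \<open>i\<close> is indispensable for some finite set \<open>insert i J\<close>.\<close>
  have tight: "\<exists>J. finite J \<and> J \<subseteq> I \<and> card (A `` J \<union> (A `` {i} - {x})) \<le> card J \<and> i \<notin> J"
    if i: "i \<in> I" "(i, x) \<in> A" for i x
  proof -
    have "insert (i, x) M \<notin> H" using max[of "insert (i, x) M"] i(2) by (auto simp: A_def)
    then obtain J where J: "finite J" "J \<subseteq> I" "card ((E - insert (i, x) M) `` J) < card J"
      unfolding H_def by (auto simp: not_le)
    have iJ: "i \<in> J"
    proof (rule ccontr)
      assume "i \<notin> J"
      then have "(E - insert (i, x) M) `` J = A `` J" by (auto simp: A_def)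
      then show False using J hallA[of J] by simp
    qed
    have "(E - insert (i, x) M) `` J = A `` (J - {i}) \<union> (A `` {i} - {x})"
      using iJ by (auto simp: A_def)
    then have "card (A `` (J - {i}) \<union> (A `` {i} - {x})) \<le> card (J - {i})"
      using J iJ by simp
    then show ?thesis using J by (intro exI[of _ "J - {i}"]) auto
  qed
  have single: "x = y" if xy: "i \<in> I" "(i, x) \<in> A" "(i, y) \<in> A" for i x y
  proof (rule ccontr)
    assume ne: "x \<noteq> y"
    obtain J where J: "finite J" "J \<subseteq> I" "card (A `` J \<union> (A `` {i} - {x})) \<le> card J" "i \<notin> J"
      using tight[OF xy(1,2)] by blast
    obtain L where L: "finite L" "L \<subseteq> I" "card (A `` L \<union> (A `` {i} - {y})) \<le> card L" "i \<notin> L"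
      using tight[OF xy(1,3)] by blast
    define P where "P = A `` J \<union> (A `` {i} - {x})"
    define Q where "Q = A `` L \<union> (A `` {i} - {y})"
    have fin: "finite P" "finite Q" using J L finA xy(1) by (auto simp: P_def Q_def)
    have "card (insert i (J \<union> L)) \<le> card (A `` insert i (J \<union> L))"
      using J L xy(1) by (intro hallA) auto
    also have "\<dots> \<le> card (P \<union> Q)"
      using fin ne by (intro card_mono) (auto simp: P_def Q_def)
    finally have 1: "Suc (card (J \<union> L)) \<le> card (P \<union> Q)" using J L by simp
    have "card (J \<inter> L) \<le> card (A `` (J \<inter> L))" using J L by (intro hallA) auto
    also have "\<dots> \<le> card (P \<inter> Q)" using fin by (intro card_mono) (auto simp: P_def Q_def)
    finally have "card (J \<inter> L) \<le> card (P \<inter> Q)" .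
    with 1 have "Suc (card J + card L) \<le> card P + card Q"
      using card_Un_Int[OF fin] card_Un_Int[OF J(1) L(1)] by linarith
    then show False using J(3) L(3) by (simp add: P_def Q_def)
  qed
  have "\<exists>x. (i, x) \<in> A" if "i \<in> I" for i
    using hallA[of "{i}"] that by (cases "A `` {i} = {}") auto
  then obtain f where f: "\<And>i. i \<in> I \<Longrightarrow> (i, f i) \<in> A" by metis
  have "inj_on f I"
  proof (rule inj_onI, rule ccontr)
    fix i j assume ij: "i \<in> I" "j \<in> I" "f i = f j" "i \<noteq> j"
    have "A `` {i} = {f i}" "A `` {j} = {f j}"
      using single[OF ij(1) _ f[OF ij(1)]] single[OF ij(2) _ f[OF ij(2)]] f ij(1,2) by blast+
    then have "A `` {i, j} = {f i}" using ij(3) by auto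
    then show False using hallA[of "{i, j}"] ij by simp
  qed
  then show ?thesis using f by (auto simp: A_def)
qed

section \<open>The Folner condition and compressions\<close>

text \<open>
  The Folner condition for a subset \<open>Y\<close> of a group: for every finite set \<open>K\<close> of translations there are
  finite nonempty subsets \<open>F\<close> of \<open>Y\<close> for which \<open>K F \<inter> Y\<close> is hardly larger than \<open>F\<close>. The ratio is
  bounded by \<open>1 + 1/n\<close>, written without division.
\<close>

definition folner_wrt :: "('g, 'm) monoid_scheme \<Rightarrow> 'g set \<Rightarrow> bool"
  where "folner_wrt G Y \<longleftrightarrow>
    (\<forall>K n. finite K \<longrightarrow> K \<subseteq> carrier G \<longrightarrow> 0 < n \<longrightarrow>
      (\<exists>F. finite F \<and> F \<noteq> {} \<and> F \<subseteq> Y \<and> n * card ((K <#>\<^bsub>G\<^esub> F) \<inter> Y) < (n + 1) * card F))"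

lemma folner_wrtE:
  assumes "folner_wrt G Y" "finite K" "K \<subseteq> carrier G" "0 < n"
  obtains F where "finite F" "F \<noteq> {}" "F \<subseteq> Y" "n * card ((K <#>\<^bsub>G\<^esub> F) \<inter> Y) < (n + 1) * card F"
proof -
  have "\<exists>F. finite F \<and> F \<noteq> {} \<and> F \<subseteq> Y \<and> n * card ((K <#>\<^bsub>G\<^esub> F) \<inter> Y) < (n + 1) * card F"
    using assms by (simp only: folner_wrt_def)
  then show ?thesis by (elim exE conjE) (rule that)
qed

text \<open>
  A compression is an injection of \<open>n + 1\<close> copies of \<open>Y\<close> into \<open>n\<close> copies of \<open>Y\<close> that moves every
  point by a left translation from a fixed finite set \<open>K\<close>. It is a paradoxical decomposition of
  \<open>Y\<close>, in a form that can be read as a matrix. For \<open>n = 0\<close> there is one only if \<open>Y\<close> is empty; for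
  empty \<open>Y\<close> every \<open>\<phi>\<close> is a compression.
\<close>

definition compression ::
  "('g, 'm) monoid_scheme \<Rightarrow> 'g set \<Rightarrow> 'g set \<Rightarrow> nat \<Rightarrow> ('g \<times> nat \<Rightarrow> 'g \<times> nat) \<Rightarrow> bool"
  where "compression G Y K n \<phi> \<longleftrightarrow>
    finite K \<and> K \<subseteq> carrier G \<and> inj_on \<phi> (Y \<times> {..<n + 1}) \<and>
    (\<forall>x\<in>Y. \<forall>i<n + 1. \<phi> (x, i) \<in> ((K #>\<^bsub>G\<^esub> x) \<inter> Y) \<times> {..<n})"

lemma finite_set_mult:
  "finite K \<Longrightarrow> finite F \<Longrightarrow> finite (K <#>\<^bsub>G\<^esub> F)"
  by (simp add: set_mult_def)

text \<open>
  Failure of the Folner condition for \<open>K\<close> and \<open>n\<close> yields Hall's condition for the relation that joins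
  \<open>(x, i)\<close> to every \<open>(y, j)\<close> with \<open>y \<in> K x\<close>.
\<close>

lemma compression_if_not_folner:
  fixes G :: "('g, 'm) monoid_scheme"
  assumes "\<not> folner_wrt G Y"
  shows "\<exists>K n \<phi>. 0 < n \<and> compression G Y K n \<phi>"
proof -
  obtain K n where K: "finite K" "K \<subseteq> carrier G" "0 < n"
    and none: "\<not> (\<exists>F. finite F \<and> F \<noteq> {} \<and> F \<subseteq> Y \<and> n * card ((K <#>\<^bsub>G\<^esub> F) \<inter> Y) < (n + 1) * card F)"
    using assms unfolding folner_wrt_def not_all not_imp by (elim exE conjE) (rule that)
  have big: "(n + 1) * card F \<le> n * card ((K <#>\<^bsub>G\<^esub> F) \<inter> Y)"
    if "finite F" "F \<noteq> {}" "F \<subseteq> Y" for F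
    by (rule ccontr) (use none that in \<open>auto simp: not_le\<close>)
  define E :: "(('g \<times> nat) \<times> ('g \<times> nat)) set"
    where "E = {((x, i), (y, j)) | x i y j. y \<in> (K #>\<^bsub>G\<^esub> x) \<inter> Y \<and> j < n}"
  have "\<exists>\<phi>. inj_on \<phi> (Y \<times> {..<n + 1}) \<and> (\<forall>p\<in>Y \<times> {..<n + 1}. (p, \<phi> p) \<in> E)"
  proof (rule infinite_marriage)
    fix p :: "'g \<times> nat"
    have "E `` {p} \<subseteq> (K #>\<^bsub>G\<^esub> fst p) \<times> {..<n}" by (auto simp: E_def)
    then show "finite (E `` {p})"
      by (rule finite_subset) (use K(1) in \<open>simp add: r_coset_def\<close>)
  next
    fix J :: "('g \<times> nat) set" assume J: "finite J" "J \<subseteq> Y \<times> {..<n + 1}"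
    define F where "F = fst ` J"
    have F: "finite F" "F \<subseteq> Y" using J by (auto simp: F_def)
    have "J \<subseteq> F \<times> {..<n + 1}" using J by (force simp: F_def)
    then have "card J \<le> card (F \<times> {..<n + 1})"
      by (rule card_mono[rotated]) (use F in simp)
    also have "\<dots> \<le> n * card ((K <#>\<^bsub>G\<^esub> F) \<inter> Y)"
      using big[of F] F by (cases "F = {}") (auto simp: mult.commute card_cartesian_product)
    also have "\<dots> = card (((K <#>\<^bsub>G\<^esub> F) \<inter> Y) \<times> {..<n})"
      by (simp add: card_cartesian_product)
    also have "((K <#>\<^bsub>G\<^esub> F) \<inter> Y) \<times> {..<n} = E `` J"
      by (force simp: E_def F_def set_mult_def r_coset_def image_iff)
    finally show "card J \<le> card (E `` J)" .
  qed
  then obtain \<phi> where \<phi>: "inj_on \<phi> (Y \<times> {..<n + 1})" "\<forall>p\<in>Y \<times> {..<n + 1}. (p, \<phi> p) \<in> E"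
    by (elim exE conjE) (rule that)
  have "\<phi> (x, i) \<in> ((K #>\<^bsub>G\<^esub> x) \<inter> Y) \<times> {..<n}" if "x \<in> Y" "i < n + 1" for x i
    using bspec[OF \<phi>(2), of "(x, i)"] that by (auto simp: E_def)
  then have "compression G Y K n \<phi>"
    unfolding compression_def using K \<phi>(1) by blast
  then show ?thesis using K(3) by blast
qed

lemma sum_disjoint_additive:
  fixes \<mu> :: "'g set \<Rightarrow> ennreal"
  assumes add: "\<And>A B. A \<subseteq> C \<Longrightarrow> B \<subseteq> C \<Longrightarrow> A \<inter> B = {} \<Longrightarrow> \<mu> (A \<union> B) = \<mu> A + \<mu> B"
    and "\<mu> {} = 0" "finite I" "\<And>i. i \<in> I \<Longrightarrow> A i \<subseteq> C" "disjoint_family_on A I"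
  shows "\<mu> (\<Union>i\<in>I. A i) = (\<Sum>i\<in>I. \<mu> (A i))"
  using assms(3-5)
proof (induction I rule: finite_induct)
  case (insert i I)
  have "A i \<inter> (\<Union>j\<in>I. A j) = {}"
    using insert.hyps insert.prems(2) by (fastforce simp: disjoint_family_on_def)
  then have "\<mu> (A i \<union> (\<Union>j\<in>I. A j)) = \<mu> (A i) + \<mu> (\<Union>j\<in>I. A j)"
    using insert.prems(1) by (intro add) auto
  moreover have "disjoint_family_on A I"
    using insert.prems(2) by (auto simp: disjoint_family_on_def)
  ultimately show ?case using insert by simp
qed (simp add: assms(2))

lemma mono_additive:
  fixes \<mu> :: "'g set \<Rightarrow> ennreal"
  assumes add: "\<And>A B. A \<subseteq> C \<Longrightarrow> B \<subseteq> C \<Longrightarrow> A \<inter> B = {} \<Longrightarrow> \<mu> (A \<union> B) = \<mu> A + \<mu> B"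
    and "A \<subseteq> B" "B \<subseteq> C"
  shows "\<mu> A \<le> \<mu> B"
proof -
  have "\<mu> (A \<union> (B - A)) = \<mu> A + \<mu> (B - A)" using assms(2,3) by (intro add) auto
  moreover have "A \<union> (B - A) = B" using assms(2) by blast
  ultimately show ?thesis by simp
qed

text \<open>
  Cutting the \<open>n + 1\<close> copies of \<open>Y\<close> into the pieces on which \<open>\<phi>\<close> is one fixed translation and
  reassembling the images inside \<open>n\<close> copies gives \<open>n + 1 \<le> n\<close> for a measure with \<open>\<mu> Y = 1\<close>.
\<close>

lemma not_amenable_if_compression:
  assumes "group G" "Y \<subseteq> carrier G" and comp: "compression G Y K n \<phi>"
  shows "\<not> amenable_wrt G Y"
proof
  interpret G: group G by fact
  assume "amenable_wrt G Y"
  then obtain \<mu> :: "'a set \<Rightarrow> ennreal" where \<mu>: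
    "\<forall>A B. A \<subseteq> carrier G \<longrightarrow> B \<subseteq> carrier G \<longrightarrow> A \<inter> B = {} \<longrightarrow> \<mu> (A \<union> B) = \<mu> A + \<mu> B"
    "\<forall>A g. A \<subseteq> carrier G \<longrightarrow> g \<in> carrier G \<longrightarrow> \<mu> (g <#\<^bsub>G\<^esub> A) = \<mu> A"
    and one: "\<mu> Y = 1"
    unfolding amenable_wrt_def by (elim exE conjE) (rule that)
  have add: "\<mu> (A \<union> B) = \<mu> A + \<mu> B"
    if "A \<subseteq> carrier G" "B \<subseteq> carrier G" "A \<inter> B = {}" for A B
    using \<mu>(1) that by simp
  have inv: "\<mu> (g <#\<^bsub>G\<^esub> A) = \<mu> A" if "A \<subseteq> carrier G" "g \<in> carrier G" for A g
    using \<mu>(2) that by simp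
  have "1 + \<mu> {} = 1" using add[of Y "{}"] assms(2) one by simp
  then have emp: "\<mu> {} = 0"
    using ennreal_add_left_cancel[of 1 "\<mu> {}" 0] by simp
  have K: "finite K" "K \<subseteq> carrier G" and inj: "inj_on \<phi> (Y \<times> {..<n + 1})"
    and \<phi>: "\<And>x i. x \<in> Y \<Longrightarrow> i < n + 1 \<Longrightarrow> \<phi> (x, i) \<in> ((K #>\<^bsub>G\<^esub> x) \<inter> Y) \<times> {..<n}"
    using comp unfolding compression_def by blast+
  \<comment> \<open>the part of the \<open>i\<close>-th copy that \<open>k\<close> translates into the \<open>j\<close>-th copy\<close>
  define A where "A i k j = {x \<in> Y. \<phi> (x, i) = (k \<otimes>\<^bsub>G\<^esub> x, j)}" for i k j
  have AY: "A i k j \<subseteq> Y" for i k j by (auto simp: A_def)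
  have AG: "A i k j \<subseteq> carrier G" for i k j using AY assms(2) by blast
  have "\<mu> Y = (\<Sum>(k, j)\<in>K \<times> {..<n}. \<mu> (A i k j))" if i: "i < n + 1" for i
  proof -
    have "Y = (\<Union>p\<in>K \<times> {..<n}. A i (fst p) (snd p))"
    proof (intro equalityI subsetI)
      fix x assume x: "x \<in> Y"
      obtain k j where "k \<in> K" "j < n" "\<phi> (x, i) = (k \<otimes>\<^bsub>G\<^esub> x, j)"
        using \<phi>[OF x i] by (auto simp: r_coset_def)
      then show "x \<in> (\<Union>p\<in>K \<times> {..<n}. A i (fst p) (snd p))"
        using x by (auto simp: A_def)
    qed (auto simp: A_def)
    moreover have "\<mu> (\<Union>p\<in>K \<times> {..<n}. A i (fst p) (snd p)) = (\<Sum>p\<in>K \<times> {..<n}. \<mu> (A i (fst p) (snd p)))"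
    proof (rule sum_disjoint_additive[OF add emp])
      show "disjoint_family_on (\<lambda>p. A i (fst p) (snd p)) (K \<times> {..<n})"
      proof (unfold disjoint_family_on_def, intro ballI impI equals0I)
        fix p q x assume pq: "p \<in> K \<times> {..<n}" "q \<in> K \<times> {..<n}" "p \<noteq> q"
          "x \<in> A i (fst p) (snd p) \<inter> A i (fst q) (snd q)"
        then have "x \<in> carrier G" "fst p \<otimes>\<^bsub>G\<^esub> x = fst q \<otimes>\<^bsub>G\<^esub> x" "snd p = snd q"
          using assms(2) by (auto simp: A_def)
        moreover have "fst p \<in> carrier G" "fst q \<in> carrier G" using pq K by auto
        ultimately show False using pq(3) by (simp add: prod_eq_iff)
      qed
    qed (use K AG[THEN subsetD] in auto)
    ultimately show ?thesis by (simp add: case_prod_unfold)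
  qed
  then have "of_nat (n + 1) = (\<Sum>i<n + 1. \<Sum>(k, j)\<in>K \<times> {..<n}. \<mu> (A i k j))"
    by (simp add: one)
  also have "\<dots> = (\<Sum>i<n + 1. \<Sum>k\<in>K. \<Sum>j<n. \<mu> (A i k j))"
    by (simp add: sum.cartesian_product)
  also have "\<dots> = (\<Sum>i<n + 1. \<Sum>j<n. \<Sum>k\<in>K. \<mu> (A i k j))"
    by (intro sum.cong refl sum.swap)
  also have "\<dots> = (\<Sum>j<n. \<Sum>i<n + 1. \<Sum>k\<in>K. \<mu> (A i k j))"
    by (rule sum.swap)
  also have "\<dots> \<le> (\<Sum>j<n. 1)"
  proof (rule sum_mono)
    fix j
    have sub: "k <#\<^bsub>G\<^esub> A i k j \<subseteq> Y" if "i < n + 1" for i k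
      using \<phi>[OF _ that] by (fastforce simp: A_def l_coset_def)
    have subG: "k <#\<^bsub>G\<^esub> A i k j \<subseteq> carrier G" if "i < n + 1" for i k
      using sub[OF that] assms(2) by blast
    have "(\<Sum>i<n + 1. \<Sum>k\<in>K. \<mu> (A i k j)) = (\<Sum>i<n + 1. \<Sum>k\<in>K. \<mu> (k <#\<^bsub>G\<^esub> A i k j))"
      using K AG by (intro sum.cong refl inv[symmetric]) auto
    also have "\<dots> = (\<Sum>p\<in>{..<n + 1} \<times> K. \<mu> (snd p <#\<^bsub>G\<^esub> A (fst p) (snd p) j))"
      by (simp add: sum.cartesian_product case_prod_unfold)
    also have "\<dots> = \<mu> (\<Union>p\<in>{..<n + 1} \<times> K. snd p <#\<^bsub>G\<^esub> A (fst p) (snd p) j)"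
    proof (rule sum_disjoint_additive[OF add emp, symmetric])
      show "disjoint_family_on (\<lambda>p. snd p <#\<^bsub>G\<^esub> A (fst p) (snd p) j) ({..<n + 1} \<times> K)"
      proof (unfold disjoint_family_on_def, intro ballI impI equals0I)
        fix p q y assume pq: "p \<in> {..<n + 1} \<times> K" "q \<in> {..<n + 1} \<times> K" "p \<noteq> q"
          "y \<in> (snd p <#\<^bsub>G\<^esub> A (fst p) (snd p) j) \<inter> (snd q <#\<^bsub>G\<^esub> A (fst q) (snd q) j)"
        have "y \<in> snd p <#\<^bsub>G\<^esub> A (fst p) (snd p) j" "y \<in> snd q <#\<^bsub>G\<^esub> A (fst q) (snd q) j"
          using pq(4) by simp_all
        then obtain x z where "x \<in> A (fst p) (snd p) j" and y: "y = snd p \<otimes>\<^bsub>G\<^esub> x"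
          and "z \<in> A (fst q) (snd q) j" and y': "y = snd q \<otimes>\<^bsub>G\<^esub> z"
          unfolding l_coset_def by (elim UN_E singletonE) (rule that)
        then have x: "x \<in> Y" "\<phi> (x, fst p) = (y, j)" and z: "z \<in> Y" "\<phi> (z, fst q) = (y, j)"
          by (simp_all add: A_def)
        have "(x, fst p) = (z, fst q)"
          using inj by (rule inj_onD) (use x z pq in auto)
        moreover have "snd p \<in> carrier G" "snd q \<in> carrier G" "x \<in> carrier G"
          using pq K x assms(2) by auto
        ultimately have "p = q" using y y' by (simp add: prod_eq_iff)
        then show False using pq by simp
      qed
    qed (use K subG[THEN subsetD] in auto)
    also have "\<dots> \<le> \<mu> Y"
      by (rule mono_additive[OF add]) (use sub[THEN subsetD] assms(2) in auto)
    finally show "(\<Sum>i<n + 1. \<Sum>k\<in>K. \<mu> (A i k j)) \<le> 1" by (simp add: one)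
  qed
  also have "\<dots> = of_nat n" by simp
  finally have "(of_nat (n + 1) :: ennreal) \<le> of_nat n" .
  then show False by (subst (asm) of_nat_le_iff) simp
qed

section \<open>From Folner sets to an invariant measure\<close>

text \<open>
  The normalised counting measures of Folner sets lie in the compact space of functions
  \<open>m\<close> from sets to \<open>[0, 1]\<close>. Additivity, \<open>m Y = 1\<close> and invariance up to \<open>1/(k+1)\<close> under a single
  translation are closed conditions, and finitely many of them always have a common solution.
\<close>

lemma invariant_mean_if_folner:
  fixes G :: "('g, 'm) monoid_scheme"
  assumes "group G" "Y \<subseteq> carrier G" "folner_wrt G Y"
  shows "\<exists>m :: 'g set \<Rightarrow> real. (\<forall>A. 0 \<le> m A) \<and>
    (\<forall>A B. A \<inter> B = {} \<longrightarrow> m (A \<union> B) = m A + m B) \<and> m Y = 1 \<and>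
    (\<forall>g\<in>carrier G. \<forall>A. A \<subseteq> Y \<longrightarrow> g <#\<^bsub>G\<^esub> A \<subseteq> Y \<longrightarrow> m (g <#\<^bsub>G\<^esub> A) = m A)"
proof -
  interpret G: group G by fact
  define S :: "('g set \<Rightarrow> real) set" where "S = PiE UNIV (\<lambda>_. {0..1})"
  define P :: "('g set \<Rightarrow> real) set"
    where "P = (\<Inter>A. \<Inter>B\<in>{B. A \<inter> B = {}}. {m. m (A \<union> B) = m A + m B}) \<inter> {m. m Y = 1}"
  define Q :: "'g \<times> nat \<Rightarrow> ('g set \<Rightarrow> real) set"
    where "Q p = (\<Inter>A\<in>{A. A \<subseteq> Y \<and> fst p <#\<^bsub>G\<^esub> A \<subseteq> Y}.
      {m. m A \<le> m (fst p <#\<^bsub>G\<^esub> A) + inverse (real (Suc (snd p)))})" for p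
  have "compactin (product_topology (\<lambda>_ :: 'g set. euclidean :: real topology) UNIV) S"
    unfolding S_def compactin_PiE by simp
  then have "compact S" by (simp add: euclidean_product_topology)
  have "closed (P \<inter> Q p)" for p
    unfolding P_def Q_def
    by (intro closed_Int closed_INT ballI closed_Collect_eq closed_Collect_le continuous_intros)
      simp_all
  moreover have "S \<inter> (\<Inter>p\<in>I. P \<inter> Q p) \<noteq> {}" if I: "finite I" "I \<subseteq> carrier G \<times> UNIV" for I
  proof -
    define K where "K = insert \<one>\<^bsub>G\<^esub> (fst ` I)"
    define n where "n = Suc (\<Sum>p\<in>I. snd p)"
    have K: "finite K" "K \<subseteq> carrier G" using I by (auto simp: K_def)
    obtain F where F: "finite F" "F \<noteq> {}" "F \<subseteq> Y"
      and small: "n * card ((K <#>\<^bsub>G\<^esub> F) \<inter> Y) < (n + 1) * card F"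
      using folner_wrtE[OF assms(3) K, of n] by (auto simp: n_def)
    define N where "N = (K <#>\<^bsub>G\<^esub> F) \<inter> Y"
    have FG: "F \<subseteq> carrier G" using F(3) assms(2) by blast
    have finN: "finite N" using K(1) F(1) by (simp add: N_def finite_set_mult)
    have cF: "0 < real (card F)" using F by (simp add: card_gt_0_iff)
    have "F \<subseteq> N"
    proof
      fix x assume x: "x \<in> F"
      then have "x = \<one>\<^bsub>G\<^esub> \<otimes>\<^bsub>G\<^esub> x" using FG by auto
      then show "x \<in> N" using x F(3) by (auto simp: N_def K_def set_mult_def)
    qed
    then have "card (N - F) + card F = card N"
      using finN F(1) by (metis card_Diff_subset card_mono le_add_diff_inverse2)
    then have "n * card (N - F) + n * card F = n * card N"
      by (metis distrib_left)
    then have "n * card (N - F) < card F" using small by (simp add: N_def)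
    then have "real n * real (card (N - F)) < real (card F)"
      by (metis of_nat_less_iff of_nat_mult)
    moreover have "0 < n" by (simp add: n_def)
    ultimately have D: "real (card (N - F)) / real (card F) \<le> inverse (real n)"
      using cF \<open>0 < n\<close> by (simp add: field_simps)
    define m where "m A = real (card (A \<inter> F)) / real (card F)" for A
    have "m \<in> S"
      using F by (auto simp: S_def m_def divide_le_eq_1 intro: card_mono)
    moreover have "m \<in> P"
    proof -
      have "m (A \<union> B) = m A + m B" if "A \<inter> B = {}" for A B
      proof -
        have "card ((A \<union> B) \<inter> F) = card (A \<inter> F) + card (B \<inter> F)"
          using F(1) that by (subst card_Un_disjoint[symmetric]) (auto simp: Int_Un_distrib2)
        then show ?thesis by (simp add: m_def add_divide_distrib)
      qed
      moreover have "m Y = 1" using F cF by (simp add: m_def Int_absorb1)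
      ultimately show ?thesis by (auto simp: P_def)
    qed
    moreover have "m \<in> Q p" if p: "p \<in> I" for p
    proof -
      have "m A \<le> m (fst p <#\<^bsub>G\<^esub> A) + inverse (real (Suc (snd p)))"
        if A: "A \<subseteq> Y" "fst p <#\<^bsub>G\<^esub> A \<subseteq> Y" for A
      proof -
        have g: "fst p \<in> K" "fst p \<in> carrier G" using p I by (auto simp: K_def)
        \<comment> \<open>A translate of a point of \<open>A \<inter> F\<close> that is not in \<open>F\<close> lies in \<open>N - F\<close>, which is small.\<close>
        have "card (A \<inter> F) \<le> card (((fst p <#\<^bsub>G\<^esub> A) \<inter> F) \<union> (N - F))"
        proof (rule card_inj_on_le)
          show "inj_on (\<lambda>x. fst p \<otimes>\<^bsub>G\<^esub> x) (A \<inter> F)"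
            using g FG by (auto intro!: inj_onI simp: subset_iff)
          show "(\<lambda>x. fst p \<otimes>\<^bsub>G\<^esub> x) ` (A \<inter> F) \<subseteq> ((fst p <#\<^bsub>G\<^esub> A) \<inter> F) \<union> (N - F)"
            using g A(2) by (auto simp: l_coset_def N_def set_mult_def)
        qed (use F finN in simp)
        also have "\<dots> \<le> card ((fst p <#\<^bsub>G\<^esub> A) \<inter> F) + card (N - F)" by (rule card_Un_le)
        finally have "real (card (A \<inter> F)) \<le> real (card ((fst p <#\<^bsub>G\<^esub> A) \<inter> F)) + real (card (N - F))"
          by linarith
        then have "m A \<le> m (fst p <#\<^bsub>G\<^esub> A) + real (card (N - F)) / real (card F)"
          using cF by (simp add: m_def divide_right_mono flip: add_divide_distrib)
        also have "real (card (N - F)) / real (card F) \<le> inverse (real (Suc (snd p)))"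
        proof -
          have "Suc (snd p) \<le> n"
            using member_le_sum[of p I snd] p I(1) by (simp add: n_def)
          then have "inverse (real n) \<le> inverse (real (Suc (snd p)))"
            by (intro le_imp_inverse_le) auto
          then show ?thesis using D by linarith
        qed
        finally show ?thesis by simp
      qed
      then show ?thesis by (auto simp: Q_def)
    qed
    ultimately show ?thesis by blast
  qed
  ultimately have "S \<inter> (\<Inter>p\<in>carrier G \<times> UNIV. P \<inter> Q p) \<noteq> {}"
    using compact_imp_fip_image[OF \<open>compact S\<close>, of "carrier G \<times> UNIV" "\<lambda>p. P \<inter> Q p"] by blast
  then obtain m where "m \<in> S \<inter> (\<Inter>p\<in>carrier G \<times> UNIV. P \<inter> Q p)" by (meson ex_in_conv)
  then have m: "m \<in> S" "\<And>p. p \<in> carrier G \<times> UNIV \<Longrightarrow> m \<in> P \<inter> Q p" by blast+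
  have le: "m A \<le> m (g <#\<^bsub>G\<^esub> A)" if A: "g \<in> carrier G" "A \<subseteq> Y" "g <#\<^bsub>G\<^esub> A \<subseteq> Y" for g A
  proof (rule field_le_epsilon)
    fix e :: real assume "0 < e"
    then obtain k where k: "inverse (real (Suc k)) < e" using reals_Archimedean by blast
    have "m \<in> Q (g, k)" using m(2)[of "(g, k)"] A(1) by simp
    then have "m A \<le> m (g <#\<^bsub>G\<^esub> A) + inverse (real (Suc k))"
      using A by (simp add: Q_def)
    then show "m A \<le> m (g <#\<^bsub>G\<^esub> A) + e" using k by linarith
  qed
  have "m (g <#\<^bsub>G\<^esub> A) = m A" if A: "g \<in> carrier G" "A \<subseteq> Y" "g <#\<^bsub>G\<^esub> A \<subseteq> Y" for g A
  proof (rule antisym)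
    have "inv\<^bsub>G\<^esub> g <#\<^bsub>G\<^esub> (g <#\<^bsub>G\<^esub> A) = A"
      using A assms(2) by (subst G.lcos_m_assoc) (auto simp: G.lcos_mult_one)
    then show "m (g <#\<^bsub>G\<^esub> A) \<le> m A" using le[of "inv\<^bsub>G\<^esub> g" "g <#\<^bsub>G\<^esub> A"] A by simp
  qed (rule le[OF A])
  moreover have "m \<in> P" using m(2)[of "(\<one>\<^bsub>G\<^esub>, 0)"] by simp
  moreover have "0 \<le> m A" for A using m(1) by (auto simp: S_def)
  ultimately show ?thesis by (intro exI[of _ m]) (auto simp: P_def)
qed

text \<open>
  The mean is invariant only under translations that stay inside \<open>Y\<close>. It is extended to all
  subsets of the group by letting \<open>\<mu> A\<close> be the supremum of the mass that can be moved into \<open>Y\<close>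
  by cutting \<open>A\<close> into finitely many pieces and translating each of them.
\<close>

lemma amenable_if_folner:
  fixes G :: "('g, 'm) monoid_scheme"
  assumes "group G" "Y \<subseteq> carrier G" "folner_wrt G Y"
  shows "amenable_wrt G Y"
proof -
  interpret G: group G by fact
  obtain m :: "'g set \<Rightarrow> real" where nonneg: "\<forall>A. 0 \<le> m A"
    and add: "\<forall>A B. A \<inter> B = {} \<longrightarrow> m (A \<union> B) = m A + m B" and m_Y: "m Y = 1"
    and inv: "\<forall>g\<in>carrier G. \<forall>A. A \<subseteq> Y \<longrightarrow> g <#\<^bsub>G\<^esub> A \<subseteq> Y \<longrightarrow> m (g <#\<^bsub>G\<^esub> A) = m A"
    using invariant_mean_if_folner[OF assms] by (elim exE conjE) (rule that)
  define M where "M A = ennreal (m A)" for A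
  have M_add: "M (A \<union> B) = M A + M B" if "A \<inter> B = {}" for A B
    using nonneg add that by (simp add: M_def ennreal_plus)
  have M_inv: "M (g <#\<^bsub>G\<^esub> A) = M A" if "g \<in> carrier G" "A \<subseteq> Y" "g <#\<^bsub>G\<^esub> A \<subseteq> Y" for g A
    using inv that by (simp add: M_def)
  have M_Y: "M Y = 1" by (simp add: M_def m_Y)
  have M_emp: "M {} = 0" using add[rule_format, of "{}" "{}"] by (simp add: M_def)
  \<comment> \<open>The map \<open>t\<close> chooses the translation for each point, and \<open>S\<close> lists the finitely many
    translations that count. The pairs \<open>(S, t)\<close> do not depend on \<open>A\<close>, so \<open>F A S t\<close> is additive in \<open>A\<close>.\<close>
  define piece where "piece t A g = (g <#\<^bsub>G\<^esub> {a \<in> A. t a = g}) \<inter> Y" for t A g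
  define F where "F A S t = (\<Sum>g\<in>S. M (piece t A g))" for A S and t :: "'g \<Rightarrow> 'g"
  define \<Theta> where "\<Theta> = {S. finite S \<and> S \<subseteq> carrier G} \<times> {t :: 'g \<Rightarrow> 'g. range t \<subseteq> carrier G}"
  define \<mu> where "\<mu> A = (SUP (S, t)\<in>\<Theta>. F A S t)" for A
  have F_le: "F A S t \<le> \<mu> A" if "(S, t) \<in> \<Theta>" for A S t
    unfolding \<mu>_def by (rule SUP_upper2[OF that]) simp
  have F_add: "F (A \<union> B) S t = F A S t + F B S t"
    if AB: "A \<subseteq> carrier G" "B \<subseteq> carrier G" "A \<inter> B = {}" and S: "S \<subseteq> carrier G" for A B S t
  proof -
    have "M (piece t (A \<union> B) g) = M (piece t A g) + M (piece t B g)" if g: "g \<in> S" for g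
    proof -
      have "piece t (A \<union> B) g = piece t A g \<union> piece t B g"
        by (auto simp: piece_def l_coset_def)
      moreover have "piece t A g \<inter> piece t B g = {}"
      proof (rule equals0I)
        fix y assume "y \<in> piece t A g \<inter> piece t B g"
        then obtain a b where "a \<in> A" "b \<in> B" "g \<otimes>\<^bsub>G\<^esub> a = g \<otimes>\<^bsub>G\<^esub> b"
          by (auto simp: piece_def l_coset_def)
        moreover from this have "a = b" using AB(1,2) S g by (auto simp: subset_iff)
        ultimately show False using AB(3) by blast
      qed
      ultimately show ?thesis by (simp add: M_add)
    qed
    then show ?thesis by (simp add: F_def sum.distrib)
  qed
  have "\<mu> (A \<union> B) = \<mu> A + \<mu> B" if AB: "A \<subseteq> carrier G" "B \<subseteq> carrier G" "A \<inter> B = {}" for A B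
  proof -
    have "\<exists>k\<in>\<Theta>. (case i of (S, t) \<Rightarrow> F A S t) + (case j of (S, t) \<Rightarrow> F B S t) \<le>
        (case k of (S, t) \<Rightarrow> F A S t) + (case k of (S, t) \<Rightarrow> F B S t)"
      if ij: "i \<in> \<Theta>" "j \<in> \<Theta>" for i j
    proof -
      obtain S t S' t' where eq: "i = (S, t)" "j = (S', t')" by (cases i, cases j)
      \<comment> \<open>The pairs \<open>(S, t)\<close> on \<open>A\<close> and \<open>(S', t')\<close> on \<open>B\<close> are combined into one.\<close>
      define u where "u a = (if a \<in> A then t a else t' a)" for a
      have u: "(S \<union> S', u) \<in> \<Theta>" using ij by (auto simp: eq \<Theta>_def u_def)
      have fin: "finite (S \<union> S')" using u by (simp add: \<Theta>_def)
      have "{a \<in> A. u a = g} = {a \<in> A. t a = g}" "{a \<in> B. u a = g} = {a \<in> B. t' a = g}" for g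
        using AB(3) by (auto simp: u_def)
      then have "piece u A = piece t A" "piece u B = piece t' B"
        by (simp_all add: piece_def fun_eq_iff)
      then have "F A S t \<le> F A (S \<union> S') u" "F B S' t' \<le> F B (S \<union> S') u"
        unfolding F_def using fin by (auto intro!: sum_mono2)
      then show ?thesis using u by (intro bexI[of _ "(S \<union> S', u)"]) (auto simp: eq intro!: add_mono)
    qed
    then have "(SUP k\<in>\<Theta>. (case k of (S, t) \<Rightarrow> F A S t) + (case k of (S, t) \<Rightarrow> F B S t)) = \<mu> A + \<mu> B"
      unfolding \<mu>_def by (rule SUP_add_directed_ennreal)
    moreover have "\<mu> (A \<union> B) = (SUP k\<in>\<Theta>. (case k of (S, t) \<Rightarrow> F A S t) + (case k of (S, t) \<Rightarrow> F B S t))"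
      unfolding \<mu>_def using F_add[OF AB] by (intro SUP_cong refl) (auto simp: \<Theta>_def)
    ultimately show ?thesis by simp
  qed
  moreover have "\<mu> (h <#\<^bsub>G\<^esub> A) = \<mu> A" if A: "A \<subseteq> carrier G" and h: "h \<in> carrier G" for A h
  proof -
    have le: "\<mu> (h <#\<^bsub>G\<^esub> A) \<le> \<mu> A" if A: "A \<subseteq> carrier G" and h: "h \<in> carrier G" for A h
      unfolding \<mu>_def[of "h <#\<^bsub>G\<^esub> A"]
    proof (rule SUP_least, clarify)
      fix S t assume S: "(S, t) \<in> \<Theta>"
      \<comment> \<open>Translating \<open>h a\<close> by \<open>s\<close> is translating \<open>a\<close> by \<open>s h\<close>.\<close>
      define S' where "S' = (\<lambda>s. s \<otimes>\<^bsub>G\<^esub> h) ` S"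
      define t' where "t' a = t (h \<otimes>\<^bsub>G\<^esub> a) \<otimes>\<^bsub>G\<^esub> h" for a
      have SG: "S \<subseteq> carrier G" "range t \<subseteq> carrier G" using S by (auto simp: \<Theta>_def)
      have "piece t (h <#\<^bsub>G\<^esub> A) s = piece t' A (s \<otimes>\<^bsub>G\<^esub> h)" if s: "s \<in> S" for s
      proof -
        have "t (h \<otimes>\<^bsub>G\<^esub> a) \<otimes>\<^bsub>G\<^esub> h = s \<otimes>\<^bsub>G\<^esub> h \<longleftrightarrow> t (h \<otimes>\<^bsub>G\<^esub> a) = s" for a
          using SG s h by (intro G.right_cancel) auto
        moreover have "s \<otimes>\<^bsub>G\<^esub> (h \<otimes>\<^bsub>G\<^esub> a) = s \<otimes>\<^bsub>G\<^esub> h \<otimes>\<^bsub>G\<^esub> a" if "a \<in> A" for a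
          using SG s h A that by (subst G.m_assoc) auto
        ultimately show ?thesis
          by (auto simp: piece_def t'_def l_coset_def)
      qed
      then have "F (h <#\<^bsub>G\<^esub> A) S t = (\<Sum>s\<in>S. M (piece t' A (s \<otimes>\<^bsub>G\<^esub> h)))"
        by (simp add: F_def)
      also have "\<dots> = F A S' t'"
        unfolding F_def S'_def using SG h
        by (subst sum.reindex) (auto intro!: inj_onI simp: subset_iff)
      also have "\<dots> \<le> \<mu> A"
        using S h range_subsetD[OF SG(2)] by (intro F_le) (auto simp: \<Theta>_def S'_def t'_def)
      finally show "F (h <#\<^bsub>G\<^esub> A) S t \<le> \<mu> A" .
    qed
    show ?thesis
    proof (rule antisym[OF le[OF A h]])
      have "inv\<^bsub>G\<^esub> h <#\<^bsub>G\<^esub> (h <#\<^bsub>G\<^esub> A) = A"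
        using A h by (subst G.lcos_m_assoc) (auto simp: G.lcos_mult_one)
      then show "\<mu> A \<le> \<mu> (h <#\<^bsub>G\<^esub> A)"
        using le[of "h <#\<^bsub>G\<^esub> A" "inv\<^bsub>G\<^esub> h"] A h by (simp add: G.l_coset_subset_G)
    qed
  qed
  moreover have "\<mu> Y = 1"
  proof (rule antisym)
    show "\<mu> Y \<le> 1"
      unfolding \<mu>_def
    proof (rule SUP_least, clarify)
      fix S t assume S: "(S, t) \<in> \<Theta>"
      define B where "B g = {a \<in> Y. t a = g \<and> g \<otimes>\<^bsub>G\<^esub> a \<in> Y}" for g
      have "piece t Y g = g <#\<^bsub>G\<^esub> B g" for g
        by (auto simp: piece_def B_def l_coset_def)
      moreover have "piece t Y g \<subseteq> Y" for g by (simp add: piece_def)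
      moreover have "B g \<subseteq> Y" for g by (auto simp: B_def)
      ultimately have "M (piece t Y g) = M (B g)" if "g \<in> S" for g
        using S that M_inv[of g "B g"] by (auto simp: \<Theta>_def)
      then have "F Y S t = (\<Sum>g\<in>S. M (B g))" by (simp add: F_def)
      also have "\<dots> = M (\<Union>g\<in>S. B g)"
        by (rule sum_disjoint_additive[where C = UNIV, symmetric])
          (use S M_emp in \<open>auto simp: M_add \<Theta>_def disjoint_family_on_def B_def\<close>)
      also have "\<dots> \<le> M Y"
        by (rule mono_additive[where C = UNIV]) (auto simp: M_add B_def)
      finally show "F Y S t \<le> 1" by (simp add: M_Y)
    qed
    have "piece (\<lambda>_. \<one>\<^bsub>G\<^esub>) Y \<one>\<^bsub>G\<^esub> = Y"
      using assms(2) by (simp add: piece_def G.lcos_mult_one)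
    then have "F Y {\<one>\<^bsub>G\<^esub>} (\<lambda>_. \<one>\<^bsub>G\<^esub>) = 1" by (simp add: F_def M_Y)
    moreover have "({\<one>\<^bsub>G\<^esub>}, \<lambda>_. \<one>\<^bsub>G\<^esub>) \<in> \<Theta>" by (auto simp: \<Theta>_def)
    ultimately show "1 \<le> \<mu> Y" using F_le by metis
  qed
  ultimately show ?thesis
    unfolding amenable_wrt_def by (intro exI[of _ \<mu>]) simp
qed

section \<open>Unbounded generating number in terms of matrices\<close>

text \<open>
  The \<open>I \<times> I\<close> identity matrix over \<open>S\<close> is the product of an \<open>I \<times> J\<close> and a \<open>J \<times> I\<close> matrix. For finite
  \<open>I\<close> and \<open>J\<close> this says that the free right module on \<open>J\<close> maps onto the one on \<open>I\<close>. Arbitrary index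
  sets save renumbering when the indices are themselves pairs.
\<close>

definition identity_factors :: "('s, 'm) ring_scheme \<Rightarrow> 'i set \<Rightarrow> 'j set \<Rightarrow> bool"
  where "identity_factors S I J \<longleftrightarrow>
    (\<exists>A B. (\<forall>i\<in>I. \<forall>j\<in>J. A i j \<in> carrier S \<and> B j i \<in> carrier S) \<and>
      (\<forall>i\<in>I. \<forall>i'\<in>I. (\<Oplus>\<^bsub>S\<^esub>j\<in>J. A i j \<otimes>\<^bsub>S\<^esub> B j i') = (if i = i' then \<one>\<^bsub>S\<^esub> else \<zero>\<^bsub>S\<^esub>)))"

lemma identity_factors_reindex:
  assumes "ring S" "identity_factors S I J" "inj_on p I'" "p ` I' \<subseteq> I" "bij_betw q J' J"
  shows "identity_factors S I' J'"
proof -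
  interpret S: ring S by fact
  obtain A B where AB: "\<forall>i\<in>I. \<forall>j\<in>J. A i j \<in> carrier S \<and> B j i \<in> carrier S"
    and id: "\<And>i i'. i \<in> I \<Longrightarrow> i' \<in> I \<Longrightarrow>
      (\<Oplus>\<^bsub>S\<^esub>j\<in>J. A i j \<otimes>\<^bsub>S\<^esub> B j i') = (if i = i' then \<one>\<^bsub>S\<^esub> else \<zero>\<^bsub>S\<^esub>)"
    using assms(2) unfolding identity_factors_def by blast
  have q: "inj_on q J'" "q ` J' = J" using assms(5) by (auto simp: bij_betw_def)
  have "(\<Oplus>\<^bsub>S\<^esub>j\<in>J'. A (p i) (q j) \<otimes>\<^bsub>S\<^esub> B (q j) (p i')) = (if i = i' then \<one>\<^bsub>S\<^esub> else \<zero>\<^bsub>S\<^esub>)"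
    if i: "i \<in> I'" "i' \<in> I'" for i i'
  proof -
    have pI: "p i \<in> I" "p i' \<in> I" using i assms(4) by auto
    have "(\<Oplus>\<^bsub>S\<^esub>j\<in>J'. A (p i) (q j) \<otimes>\<^bsub>S\<^esub> B (q j) (p i')) = (\<Oplus>\<^bsub>S\<^esub>j\<in>q ` J'. A (p i) j \<otimes>\<^bsub>S\<^esub> B j (p i'))"
      by (rule S.finsum_reindex[symmetric]) (use q AB pI in auto)
    then show ?thesis using id[OF pI] q i assms(3) by (auto simp: inj_on_def)
  qed
  moreover have "\<forall>i\<in>I'. \<forall>j\<in>J'. A (p i) (q j) \<in> carrier S \<and> B (q j) (p i) \<in> carrier S"
    using AB q(2) assms(4) by blast
  ultimately show ?thesis
    unfolding identity_factors_def
    by (intro exI[of _ "\<lambda>i j. A (p i) (q j)"] exI[of _ "\<lambda>j i. B (q j) (p i)"]) auto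
qed

text \<open>
  The \<open>k\<close>-th standard basis vector of the free module of rank \<open>n\<close>; for \<open>k \<ge> n\<close> it is zero.
\<close>

definition unit_vector :: "('s, 'm) ring_scheme \<Rightarrow> nat \<Rightarrow> nat \<Rightarrow> nat \<Rightarrow> 's"
  where "unit_vector S n k = (\<lambda>i\<in>{..<n}. if i = k then \<one>\<^bsub>S\<^esub> else \<zero>\<^bsub>S\<^esub>)"

lemma free_right_module_hom_expand:
  assumes "ring S" and f: "f \<in> right_module_hom S (free_right_module S n) (free_right_module S m)"
    and v: "v \<in> carrier (free_right_module S n)" and i: "i < m"
  shows "f v i = (\<Oplus>\<^bsub>S\<^esub>k\<in>{..<n}. f (unit_vector S n k) i \<otimes>\<^bsub>S\<^esub> v k)"
proof -
  interpret S: ring S by fact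
  have closed: "f w \<in> {..<m} \<rightarrow>\<^sub>E carrier S" if "w \<in> {..<n} \<rightarrow>\<^sub>E carrier S" for w
    using f that by (auto simp: right_module_hom_def free_right_module_def)
  have add: "f (\<lambda>i\<in>{..<n}. w i \<oplus>\<^bsub>S\<^esub> w' i) i = f w i \<oplus>\<^bsub>S\<^esub> f w' i"
    if "w \<in> {..<n} \<rightarrow>\<^sub>E carrier S" "w' \<in> {..<n} \<rightarrow>\<^sub>E carrier S" for w w'
    using f that i by (simp add: right_module_hom_def free_right_module_def)
  have smult: "f (\<lambda>i\<in>{..<n}. w i \<otimes>\<^bsub>S\<^esub> s) i = f w i \<otimes>\<^bsub>S\<^esub> s"
    if "w \<in> {..<n} \<rightarrow>\<^sub>E carrier S" "s \<in> carrier S" for w s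
    using f that i by (simp add: right_module_hom_def free_right_module_def)
  have unit: "unit_vector S n k \<in> {..<n} \<rightarrow>\<^sub>E carrier S" for k
    by (simp add: unit_vector_def)
  have vk: "v k \<in> carrier S" if "k < n" for k
    using v that by (auto simp: free_right_module_def)
  have fe: "f (unit_vector S n k) i \<in> carrier S" for k
    using closed[OF unit] i by auto
  \<comment> \<open>\<open>u l\<close> is \<open>v\<close> with the coordinates from \<open>l\<close> on replaced by zero.\<close>
  define u where "u l = (\<lambda>k\<in>{..<n}. if k < l then v k else \<zero>\<^bsub>S\<^esub>)" for l
  have u: "u l \<in> {..<n} \<rightarrow>\<^sub>E carrier S" for l
    using vk by (auto simp: u_def)
  have "l \<le> n \<Longrightarrow> f (u l) i = (\<Oplus>\<^bsub>S\<^esub>k\<in>{..<l}. f (unit_vector S n k) i \<otimes>\<^bsub>S\<^esub> v k)" for l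
  proof (induction l)
    case 0
    have "u 0 = (\<lambda>i\<in>{..<n}. u 0 i \<otimes>\<^bsub>S\<^esub> \<zero>\<^bsub>S\<^esub>)" by (auto simp: u_def fun_eq_iff)
    then have "f (u 0) i = f (u 0) i \<otimes>\<^bsub>S\<^esub> \<zero>\<^bsub>S\<^esub>"
      using smult[OF u[of 0], of "\<zero>\<^bsub>S\<^esub>"] by simp
    also have "\<dots> = \<zero>\<^bsub>S\<^esub>" using closed[OF u[of 0]] i by (intro S.r_null) auto
    finally show ?case by simp
  next
    case (Suc l)
    let ?w = "\<lambda>i\<in>{..<n}. unit_vector S n l i \<otimes>\<^bsub>S\<^esub> v l"
    have w: "?w \<in> {..<n} \<rightarrow>\<^sub>E carrier S"
      using Suc.prems vk by (auto simp: unit_vector_def)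
    have "u (Suc l) = (\<lambda>i\<in>{..<n}. ?w i \<oplus>\<^bsub>S\<^esub> u l i)"
      using vk Suc.prems by (auto simp: u_def fun_eq_iff unit_vector_def less_Suc_eq)
    then have "f (u (Suc l)) i = f ?w i \<oplus>\<^bsub>S\<^esub> f (u l) i" using add[OF w u] by simp
    also have "f ?w i = f (unit_vector S n l) i \<otimes>\<^bsub>S\<^esub> v l"
      using smult[OF unit] vk Suc.prems by simp
    finally show ?case
      using Suc fe vk by (simp add: lessThan_Suc S.finsum_insert Pi_iff)
  qed
  from this[of n] have "f (u n) i = (\<Oplus>\<^bsub>S\<^esub>k\<in>{..<n}. f (unit_vector S n k) i \<otimes>\<^bsub>S\<^esub> v k)" by simp
  moreover have "u n = v" using v by (auto simp: u_def fun_eq_iff free_right_module_def PiE_iff extensional_def)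
  ultimately show ?thesis by simp
qed

lemma identity_factors_if_epi:
  assumes "ring S" and f: "f \<in> right_module_epi S (free_right_module S n) (free_right_module S m)"
  shows "identity_factors S {..<m} {..<n}"
proof -
  interpret S: ring S by fact
  have hom: "f \<in> right_module_hom S (free_right_module S n) (free_right_module S m)"
    and surj: "f ` carrier (free_right_module S n) = carrier (free_right_module S m)"
    using f by (auto simp: right_module_epi_def)
  have unit: "unit_vector S l k \<in> carrier (free_right_module S l)" for k l
    by (simp add: unit_vector_def free_right_module_def)
  have "\<exists>v. \<forall>k. v k \<in> carrier (free_right_module S n) \<and> f (v k) = unit_vector S m k"
    using unit[of m] surj by (intro choice) (metis imageE)
  then obtain v where v: "\<And>k. v k \<in> carrier (free_right_module S n)" "\<And>k. f (v k) = unit_vector S m k"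
    by blast
  have "f (unit_vector S n k) \<in> carrier (free_right_module S m)" for k
    using surj unit[of n k] by blast
  then have "f (unit_vector S n k) i \<in> carrier S" if "i < m" for i k
    using that by (auto simp: free_right_module_def)
  moreover have "v j k \<in> carrier S" if "k < n" for j k
    using v(1)[of j] that by (auto simp: free_right_module_def)
  moreover have "(\<Oplus>\<^bsub>S\<^esub>k\<in>{..<n}. f (unit_vector S n k) i \<otimes>\<^bsub>S\<^esub> v j k) = (if i = j then \<one>\<^bsub>S\<^esub> else \<zero>\<^bsub>S\<^esub>)"
    if "i < m" for i j
    using free_right_module_hom_expand[OF assms(1) hom v(1) that, of j] v(2)[of j] that
    by (simp add: unit_vector_def)
  ultimately show ?thesis
    unfolding identity_factors_def
    by (intro exI[of _ "\<lambda>i k. f (unit_vector S n k) i"] exI[of _ "\<lambda>k j. v j k"]) auto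
qed

lemma epi_if_identity_factors:
  assumes "ring S" "identity_factors S {..<m} {..<n}"
  shows "\<exists>f. f \<in> right_module_epi S (free_right_module S n) (free_right_module S m)"
proof -
  interpret S: ring S by fact
  obtain A B where "\<forall>i\<in>{..<m}. \<forall>j\<in>{..<n}. A i j \<in> carrier S \<and> B j i \<in> carrier S"
    "\<forall>i\<in>{..<m}. \<forall>i'\<in>{..<m}.
      (\<Oplus>\<^bsub>S\<^esub>j\<in>{..<n}. A i j \<otimes>\<^bsub>S\<^esub> B j i') = (if i = i' then \<one>\<^bsub>S\<^esub> else \<zero>\<^bsub>S\<^esub>)"
    using assms(2) unfolding identity_factors_def by blast
  then have AB: "\<And>i j. i < m \<Longrightarrow> j < n \<Longrightarrow> A i j \<in> carrier S"
      "\<And>i j. i < m \<Longrightarrow> j < n \<Longrightarrow> B j i \<in> carrier S"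
    and id: "\<And>i i'. i < m \<Longrightarrow> i' < m \<Longrightarrow>
      (\<Oplus>\<^bsub>S\<^esub>j\<in>{..<n}. A i j \<otimes>\<^bsub>S\<^esub> B j i') = (if i = i' then \<one>\<^bsub>S\<^esub> else \<zero>\<^bsub>S\<^esub>)"
    by blast+
  define f where "f v = (\<lambda>i\<in>{..<m}. \<Oplus>\<^bsub>S\<^esub>k\<in>{..<n}. A i k \<otimes>\<^bsub>S\<^esub> v k)" for v
  have closed: "f v \<in> {..<m} \<rightarrow>\<^sub>E carrier S" if "v \<in> {..<n} \<rightarrow>\<^sub>E carrier S" for v
    using that AB by (auto simp: f_def intro!: S.finsum_closed)
  have "f \<in> right_module_hom S (free_right_module S n) (free_right_module S m)"
    unfolding right_module_hom_def
  proof (intro CollectI conjI ballI)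
    show "f \<in> carrier (free_right_module S n) \<rightarrow> carrier (free_right_module S m)"
      using closed by (auto simp: free_right_module_def)
  next
    fix v w assume "v \<in> carrier (free_right_module S n)" "w \<in> carrier (free_right_module S n)"
    then have vw: "\<And>k. k < n \<Longrightarrow> v k \<in> carrier S" "\<And>k. k < n \<Longrightarrow> w k \<in> carrier S"
      by (auto simp: free_right_module_def)
    have "(\<Oplus>\<^bsub>S\<^esub>k\<in>{..<n}. A i k \<otimes>\<^bsub>S\<^esub> (\<lambda>i\<in>{..<n}. v i \<oplus>\<^bsub>S\<^esub> w i) k) =
        (\<Oplus>\<^bsub>S\<^esub>k\<in>{..<n}. A i k \<otimes>\<^bsub>S\<^esub> v k) \<oplus>\<^bsub>S\<^esub> (\<Oplus>\<^bsub>S\<^esub>k\<in>{..<n}. A i k \<otimes>\<^bsub>S\<^esub> w k)" if "i < m" for i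
    proof -
      have "(\<Oplus>\<^bsub>S\<^esub>k\<in>{..<n}. A i k \<otimes>\<^bsub>S\<^esub> (\<lambda>i\<in>{..<n}. v i \<oplus>\<^bsub>S\<^esub> w i) k) =
          (\<Oplus>\<^bsub>S\<^esub>k\<in>{..<n}. A i k \<otimes>\<^bsub>S\<^esub> v k \<oplus>\<^bsub>S\<^esub> A i k \<otimes>\<^bsub>S\<^esub> w k)"
        using vw AB that by (intro S.finsum_cong') (auto simp: S.r_distr)
      then show ?thesis using vw AB that by (simp add: S.finsum_addf Pi_iff)
    qed
    then show "f (v \<oplus>\<^bsub>free_right_module S n\<^esub> w) = f v \<oplus>\<^bsub>free_right_module S m\<^esub> f w"
      by (auto simp: free_right_module_def f_def fun_eq_iff)
  next
    fix s v assume s: "s \<in> carrier S" and "v \<in> carrier (free_right_module S n)"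
    then have v: "\<And>k. k < n \<Longrightarrow> v k \<in> carrier S" by (auto simp: free_right_module_def)
    have "(\<Oplus>\<^bsub>S\<^esub>k\<in>{..<n}. A i k \<otimes>\<^bsub>S\<^esub> (\<lambda>i\<in>{..<n}. v i \<otimes>\<^bsub>S\<^esub> s) k) =
        (\<Oplus>\<^bsub>S\<^esub>k\<in>{..<n}. A i k \<otimes>\<^bsub>S\<^esub> v k) \<otimes>\<^bsub>S\<^esub> s" if "i < m" for i
    proof -
      have "(\<Oplus>\<^bsub>S\<^esub>k\<in>{..<n}. A i k \<otimes>\<^bsub>S\<^esub> (\<lambda>i\<in>{..<n}. v i \<otimes>\<^bsub>S\<^esub> s) k) =
          (\<Oplus>\<^bsub>S\<^esub>k\<in>{..<n}. (A i k \<otimes>\<^bsub>S\<^esub> v k) \<otimes>\<^bsub>S\<^esub> s)"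
        using v AB that s by (intro S.finsum_cong') (auto simp: S.m_assoc)
      then show ?thesis using v AB that s by (simp add: S.finsum_ldistr Pi_iff)
    qed
    then show "f (s \<odot>\<^bsub>free_right_module S n\<^esub> v) = s \<odot>\<^bsub>free_right_module S m\<^esub> f v"
      by (auto simp: free_right_module_def f_def fun_eq_iff)
  qed
  moreover have "f ` carrier (free_right_module S n) = carrier (free_right_module S m)"
  proof (intro equalityI subsetI)
    fix w assume w: "w \<in> carrier (free_right_module S m)"
    then have wi: "\<And>i. i < m \<Longrightarrow> w i \<in> carrier S" by (auto simp: free_right_module_def)
    define v where "v = (\<lambda>k\<in>{..<n}. \<Oplus>\<^bsub>S\<^esub>i\<in>{..<m}. B k i \<otimes>\<^bsub>S\<^esub> w i)"
    have v: "v \<in> carrier (free_right_module S n)"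
      using AB wi by (auto simp: v_def free_right_module_def intro!: S.finsum_closed)
    have "f v i = w i" if i: "i < m" for i
    proof -
      have "f v i = (\<Oplus>\<^bsub>S\<^esub>k\<in>{..<n}. \<Oplus>\<^bsub>S\<^esub>j\<in>{..<m}. (A i k \<otimes>\<^bsub>S\<^esub> B k j) \<otimes>\<^bsub>S\<^esub> w j)"
        unfolding f_def v_def restrict_apply using i AB wi
        by (auto simp: S.finsum_rdistr S.m_assoc Pi_iff intro!: S.finsum_cong' S.finsum_closed)
      also have "\<dots> = (\<Oplus>\<^bsub>S\<^esub>j\<in>{..<m}. \<Oplus>\<^bsub>S\<^esub>k\<in>{..<n}. (A i k \<otimes>\<^bsub>S\<^esub> B k j) \<otimes>\<^bsub>S\<^esub> w j)"
        using i AB wi by (intro S.finsum_exchange) auto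
      also have "\<dots> = (\<Oplus>\<^bsub>S\<^esub>j\<in>{..<m}. (if i = j then w j else \<zero>\<^bsub>S\<^esub>))"
      proof (rule S.finsum_cong')
        fix j assume "j \<in> {..<m}"
        then have j: "j < m" by simp
        have "(\<Oplus>\<^bsub>S\<^esub>k\<in>{..<n}. (A i k \<otimes>\<^bsub>S\<^esub> B k j) \<otimes>\<^bsub>S\<^esub> w j) = (\<Oplus>\<^bsub>S\<^esub>k\<in>{..<n}. A i k \<otimes>\<^bsub>S\<^esub> B k j) \<otimes>\<^bsub>S\<^esub> w j"
          using i j AB wi by (simp add: S.finsum_ldistr Pi_iff)
        then show "(\<Oplus>\<^bsub>S\<^esub>k\<in>{..<n}. (A i k \<otimes>\<^bsub>S\<^esub> B k j) \<otimes>\<^bsub>S\<^esub> w j) = (if i = j then w j else \<zero>\<^bsub>S\<^esub>)"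
          using id[OF i j] wi j by simp
      qed (use wi in auto)
      also have "\<dots> = w i"
        using S.add.finprod_singleton[of i "{..<m}" w] i wi by auto
      finally show ?thesis .
    qed
    moreover have "f v \<in> {..<m} \<rightarrow>\<^sub>E carrier S" "w \<in> {..<m} \<rightarrow>\<^sub>E carrier S"
      using closed v w by (auto simp: free_right_module_def)
    ultimately have "f v = w" by (intro PiE_ext) auto
    then show "w \<in> f ` carrier (free_right_module S n)" using v by blast
  qed (use closed in \<open>auto simp: free_right_module_def\<close>)
  ultimately show ?thesis by (auto simp: right_module_epi_def)
qed

lemma not_UGN_iff:
  assumes "ring S"
  shows "\<not> UGN S \<longleftrightarrow> (\<exists>n :: nat. n > 0 \<and> identity_factors S {..<n + 1} {..<n})"
proof -
  have "(\<exists>f. f \<in> right_module_epi S (free_right_module S n) (free_right_module S m)) \<longleftrightarrow>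
      identity_factors S {..<m} {..<n}" for m n
    using identity_factors_if_epi[OF assms] epi_if_identity_factors[OF assms] by blast
  then show ?thesis unfolding UGN_def by simp
qed

text \<open>
  Discarding rows of the left factor and columns of the right one reduces the gap between
  \<open>card J\<close> and \<open>card I\<close> to one.
\<close>

lemma not_UGN_if_identity_factors:
  assumes "ring S" "identity_factors S I J" "finite J" "J \<noteq> {}" "card J < card I"
  shows "\<not> UGN S"
proof -
  define n where "n = card J"
  have fI: "finite I" using assms(5) using card.infinite by fastforce
  obtain q where "bij_betw q {..<n} J"
    using ex_bij_betw_nat_finite[OF assms(3)] by (auto simp: n_def atLeast0LessThan)
  moreover obtain p where "bij_betw p {..<card I} I"
    using ex_bij_betw_nat_finite[OF fI] by (auto simp: atLeast0LessThan)
  then have "inj_on p {..<n + 1}" "p ` {..<n + 1} \<subseteq> I"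
    using assms(5) by (auto simp: bij_betw_def n_def intro: inj_on_subset)
  ultimately have "identity_factors S {..<n + 1} {..<n}"
    using identity_factors_reindex[OF assms(1,2)] by blast
  moreover have "n > 0" using assms(3,4) by (simp add: n_def card_gt_0_iff)
  ultimately show ?thesis using not_UGN_iff[OF assms(1)] by blast
qed

lemma finsum_hom:
  assumes "ring R" "ring S" "h \<in> ring_hom R S" "finite A" "\<And>a. a \<in> A \<Longrightarrow> f a \<in> carrier R"
  shows "h (\<Oplus>\<^bsub>R\<^esub>a\<in>A. f a) = (\<Oplus>\<^bsub>S\<^esub>a\<in>A. h (f a))"
proof -
  interpret R: ring R by fact
  interpret S: ring S by fact
  interpret h: ring_hom_ring R S h
    by (rule ring_hom_ringI2) fact+
  show ?thesis
    using assms(4,5) by (induction A rule: finite_induct) (auto simp: Pi_iff)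
qed

lemma UGN_ring_hom:
  assumes "ring R" "ring S" "h \<in> ring_hom R S" "UGN S"
  shows "UGN R"
proof (rule ccontr)
  interpret R: ring R by fact
  interpret S: ring S by fact
  interpret h: ring_hom_ring R S h
    by (rule ring_hom_ringI2) fact+
  assume "\<not> UGN R"
  then obtain n :: nat where n: "n > 0" and "identity_factors R {..<n + 1} {..<n}"
    unfolding not_UGN_iff[OF assms(1)] by blast
  then obtain A B where "\<forall>i\<in>{..<n + 1}. \<forall>j\<in>{..<n}. A i j \<in> carrier R \<and> B j i \<in> carrier R"
    "\<forall>i\<in>{..<n + 1}. \<forall>i'\<in>{..<n + 1}.
      (\<Oplus>\<^bsub>R\<^esub>j\<in>{..<n}. A i j \<otimes>\<^bsub>R\<^esub> B j i') = (if i = i' then \<one>\<^bsub>R\<^esub> else \<zero>\<^bsub>R\<^esub>)"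
    unfolding identity_factors_def by blast
  then have AB: "\<And>i j. i < n + 1 \<Longrightarrow> j < n \<Longrightarrow> A i j \<in> carrier R"
      "\<And>i j. i < n + 1 \<Longrightarrow> j < n \<Longrightarrow> B j i \<in> carrier R"
    and id: "\<And>i i'. i < n + 1 \<Longrightarrow> i' < n + 1 \<Longrightarrow>
      (\<Oplus>\<^bsub>R\<^esub>j\<in>{..<n}. A i j \<otimes>\<^bsub>R\<^esub> B j i') = (if i = i' then \<one>\<^bsub>R\<^esub> else \<zero>\<^bsub>R\<^esub>)"
    by blast+
  have "(\<Oplus>\<^bsub>S\<^esub>j\<in>{..<n}. h (A i j) \<otimes>\<^bsub>S\<^esub> h (B j i')) = (if i = i' then \<one>\<^bsub>S\<^esub> else \<zero>\<^bsub>S\<^esub>)"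
    if i: "i < n + 1" "i' < n + 1" for i i'
  proof -
    have "(\<Oplus>\<^bsub>S\<^esub>j\<in>{..<n}. h (A i j) \<otimes>\<^bsub>S\<^esub> h (B j i')) = (\<Oplus>\<^bsub>S\<^esub>j\<in>{..<n}. h (A i j \<otimes>\<^bsub>R\<^esub> B j i'))"
      using AB i by (intro S.finsum_cong') auto
    also have "\<dots> = h (\<Oplus>\<^bsub>R\<^esub>j\<in>{..<n}. A i j \<otimes>\<^bsub>R\<^esub> B j i')"
      using AB i by (intro finsum_hom[symmetric] assms) auto
    finally show ?thesis using id[OF i] by simp
  qed
  then have "identity_factors S {..<n + 1} {..<n}"
    unfolding identity_factors_def using AB
    by (intro exI[of _ "\<lambda>i j. h (A i j)"] exI[of _ "\<lambda>j i. h (B j i)"]) auto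
  then show False using n assms(4) not_UGN_iff[OF assms(2)] by blast
qed

section \<open>Rings of translation matrices\<close>

text \<open>
  The diagonal \<open>Y \<times> Y\<close> matrix all of whose diagonal entries are \<open>r\<close>; it is \<open>undefined\<close> outside
  \<open>Y \<times> Y\<close>, as the elements of the translation ring are.
\<close>

definition scalar_matrix :: "'g set \<Rightarrow> ('r, 'n) ring_scheme \<Rightarrow> 'r \<Rightarrow> 'g \<times> 'g \<Rightarrow> 'r"
  where "scalar_matrix Y R r = (\<lambda>(x, y)\<in>Y \<times> Y. if x = y then r else \<zero>\<^bsub>R\<^esub>)"

lemma scalar_matrix_hom:
  assumes "group G" "Y \<subseteq> carrier G" "ring R"
  shows "scalar_matrix Y R \<in> ring_hom R (translation_ring G Y R)"
proof -
  interpret R: ring R by fact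
  interpret G: group G by fact
  have mem: "scalar_matrix Y R r \<in> translation_matrices G Y R" if "r \<in> carrier R" for r
    by (rule translation_matrices_memI[of "{\<one>\<^bsub>G\<^esub>}"])
      (use assms(2) that in \<open>auto simp: scalar_matrix_def r_coset_def subset_iff\<close>)
  show ?thesis
  proof (rule ring_hom_memI)
    fix r s assume rs: "r \<in> carrier R" "s \<in> carrier R"
    show "scalar_matrix Y R (r \<otimes>\<^bsub>R\<^esub> s) =
        scalar_matrix Y R r \<otimes>\<^bsub>translation_ring G Y R\<^esub> scalar_matrix Y R s"
    proof (rule translation_matrices_eqI[where Y = Y])
      fix x y assume xy: "x \<in> Y" "y \<in> Y"
      have "(scalar_matrix Y R r \<otimes>\<^bsub>translation_ring G Y R\<^esub> scalar_matrix Y R s) (x, y) =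
          (\<Oplus>\<^bsub>R\<^esub>z\<in>{x}. scalar_matrix Y R r (x, z) \<otimes>\<^bsub>R\<^esub> scalar_matrix Y R s (z, y))"
        by (rule translation_mult_entry[OF assms(3) mem mem])
          (use rs xy in \<open>auto simp: scalar_matrix_def split: if_splits\<close>)
      then show "scalar_matrix Y R (r \<otimes>\<^bsub>R\<^esub> s) (x, y) =
          (scalar_matrix Y R r \<otimes>\<^bsub>translation_ring G Y R\<^esub> scalar_matrix Y R s) (x, y)"
        using xy rs by (simp add: scalar_matrix_def)
    qed (simp_all add: scalar_matrix_def translation_ring_def)
  qed (use mem in \<open>auto simp: translation_ring_def scalar_matrix_def fun_eq_iff\<close>)
qed

lemma translation_finsum_entry:
  assumes "group G" "Y \<subseteq> carrier G" "ring R" "finite A"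
    and "\<And>a. a \<in> A \<Longrightarrow> M a \<in> translation_matrices G Y R" and xy: "x \<in> Y" "y \<in> Y"
  shows "(\<Oplus>\<^bsub>translation_ring G Y R\<^esub>a\<in>A. M a) (x, y) = (\<Oplus>\<^bsub>R\<^esub>a\<in>A. M a (x, y))"
proof -
  interpret R: ring R by fact
  interpret T: ring "translation_ring G Y R" by (rule ring_translation_ring) fact+
  have carrier: "carrier (translation_ring G Y R) = translation_matrices G Y R"
    by (simp add: translation_ring_def)
  show ?thesis
    using assms(4,5)
  proof (induction A rule: finite_induct)
    case empty
    then show ?case using xy by (simp, simp add: translation_ring_def)
  next
    case (insert a A)
    have "(\<Oplus>\<^bsub>translation_ring G Y R\<^esub>a\<in>insert a A. M a) (x, y) =
        (M a \<oplus>\<^bsub>translation_ring G Y R\<^esub> (\<Oplus>\<^bsub>translation_ring G Y R\<^esub>a\<in>A. M a)) (x, y)"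
      using insert by (subst T.finsum_insert) (auto simp: carrier)
    also have "\<dots> = M a (x, y) \<oplus>\<^bsub>R\<^esub> (\<Oplus>\<^bsub>translation_ring G Y R\<^esub>a\<in>A. M a) (x, y)"
      using xy by (simp add: translation_ring_def)
    finally show ?case
      using insert xy by (subst R.finsum_insert) (auto intro: translation_matrices_entry)
  qed
qed

lemma finsum_Times:
  assumes "abelian_monoid R" "finite A" "finite B" "\<And>a b. a \<in> A \<Longrightarrow> b \<in> B \<Longrightarrow> f a b \<in> carrier R"
  shows "(\<Oplus>\<^bsub>R\<^esub>p\<in>A \<times> B. f (fst p) (snd p)) = (\<Oplus>\<^bsub>R\<^esub>b\<in>B. \<Oplus>\<^bsub>R\<^esub>a\<in>A. f a b)"
proof -
  interpret R: abelian_monoid R by fact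
  show ?thesis
    using assms(3,4)
  proof (induction B rule: finite_induct)
    case (insert b B)
    have "A \<times> insert b B = (\<lambda>a. (a, b)) ` A \<union> A \<times> B" by auto
    then have "(\<Oplus>\<^bsub>R\<^esub>p\<in>A \<times> insert b B. f (fst p) (snd p)) =
        (\<Oplus>\<^bsub>R\<^esub>p\<in>(\<lambda>a. (a, b)) ` A. f (fst p) (snd p)) \<oplus>\<^bsub>R\<^esub> (\<Oplus>\<^bsub>R\<^esub>p\<in>A \<times> B. f (fst p) (snd p))"
      using insert assms(2) by (simp only:) (rule R.finsum_Un_disjoint, auto)
    also have "(\<Oplus>\<^bsub>R\<^esub>p\<in>(\<lambda>a. (a, b)) ` A. f (fst p) (snd p)) = (\<Oplus>\<^bsub>R\<^esub>a\<in>A. f a b)"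
      using insert.prems by (subst R.finsum_reindex) (auto simp: inj_on_def)
    finally show ?case
      using insert by (subst R.finsum_insert) (auto intro!: R.finsum_closed)
  qed simp
qed

lemma translation_delta_entry:
  assumes "x \<in> Y" "y \<in> Y"
  shows "(if i = j then \<one>\<^bsub>translation_ring G Y R\<^esub> else \<zero>\<^bsub>translation_ring G Y R\<^esub>) (x, y) =
    (if (x, i) = (y, j) then \<one>\<^bsub>R\<^esub> else \<zero>\<^bsub>R\<^esub>)"
  using assms by (simp add: translation_ring_def)

text \<open>
  The 0-1 matrix of an injection, multiplied by its transpose, is the identity. For a compression
  the blocks, one for each pair of a copy in the source and a copy in the target, are translation
  matrices because only translations from \<open>K\<close> (and their inverses, for the transpose) occur.
\<close>

lemma not_UGN_translation_if_compression:
  assumes "group G" "Y \<subseteq> carrier G" "ring R" "0 < n" "compression G Y K n \<phi>"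
  shows "\<not> UGN (translation_ring G Y R)"
proof -
  interpret G: group G by fact
  interpret R: ring R by fact
  let ?T = "translation_ring G Y R"
  interpret T: ring ?T by (rule ring_translation_ring) fact+
  have K: "finite K" "K \<subseteq> carrier G" and inj: "inj_on \<phi> (Y \<times> {..<n + 1})"
    and \<phi>: "\<And>x i. x \<in> Y \<Longrightarrow> i < n + 1 \<Longrightarrow> \<phi> (x, i) \<in> ((K #>\<^bsub>G\<^esub> x) \<inter> Y) \<times> {..<n}"
    using assms(5) unfolding compression_def by blast+
  define A where "A i k = (\<lambda>(x, y)\<in>Y \<times> Y. if \<phi> (x, i) = (y, k) then \<one>\<^bsub>R\<^esub> else \<zero>\<^bsub>R\<^esub>)" for i k
  define B where "B k i = (\<lambda>(y, x)\<in>Y \<times> Y. if \<phi> (x, i) = (y, k) then \<one>\<^bsub>R\<^esub> else \<zero>\<^bsub>R\<^esub>)" for k i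
  have A: "A i k \<in> translation_matrices G Y R" if "i < n + 1" for i k
    by (rule translation_matrices_memI[of K]) (use K \<phi>[OF _ that] in \<open>force simp: A_def\<close>)+
  have B: "B k i \<in> translation_matrices G Y R" if i: "i < n + 1" for i k
  proof (rule translation_matrices_memI[of "m_inv G ` K"])
    fix y x assume yx: "y \<in> Y" "x \<in> Y" and x: "x \<notin> m_inv G ` K #>\<^bsub>G\<^esub> y"
    have "\<phi> (x, i) \<noteq> (y, k)"
    proof
      assume "\<phi> (x, i) = (y, k)"
      then obtain c where c: "c \<in> K" "y = c \<otimes>\<^bsub>G\<^esub> x"
        using \<phi>[OF yx(2) i] by (auto simp: r_coset_def)
      have "c \<in> carrier G" "x \<in> carrier G" using c K yx assms(2) by auto
      then have "x = inv\<^bsub>G\<^esub> c \<otimes>\<^bsub>G\<^esub> y" using c(2) by (simp add: G.m_assoc[symmetric])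
      then show False using x c(1) by (auto simp: r_coset_def)
    qed
    then show "B k i (y, x) = \<zero>\<^bsub>R\<^esub>" using yx by (simp add: B_def)
  qed (use K in \<open>auto simp: B_def\<close>)
  have carrier: "carrier ?T = translation_matrices G Y R"
    by (simp add: translation_ring_def)
  have AB: "A i k \<otimes>\<^bsub>?T\<^esub> B k j \<in> translation_matrices G Y R" if "i < n + 1" "j < n + 1" for i j k
    using A[OF that(1)] B[OF that(2)] by (intro translation_mult_closed assms)
  have "(\<Oplus>\<^bsub>?T\<^esub>k\<in>{..<n}. A i k \<otimes>\<^bsub>?T\<^esub> B k j) = (if i = j then \<one>\<^bsub>?T\<^esub> else \<zero>\<^bsub>?T\<^esub>)"
    if ij: "i < n + 1" "j < n + 1" for i j
  proof (rule translation_matrices_eqI[where Y = Y])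
    have "(\<Oplus>\<^bsub>?T\<^esub>k\<in>{..<n}. A i k \<otimes>\<^bsub>?T\<^esub> B k j) \<in> carrier ?T"
      using AB[OF ij] by (intro T.finsum_closed) (auto simp: carrier)
    then show "(\<Oplus>\<^bsub>?T\<^esub>k\<in>{..<n}. A i k \<otimes>\<^bsub>?T\<^esub> B k j) \<in> extensional (Y \<times> Y)"
      by (simp add: carrier translation_matrices_def PiE_iff)
  next
    fix x x' assume x: "x \<in> Y" "x' \<in> Y"
    obtain y l where y: "\<phi> (x, i) = (y, l)" by (cases "\<phi> (x, i)")
    then have yl: "y \<in> Y" "l < n" using \<phi>[OF x(1) ij(1)] by auto
    have "(A i k \<otimes>\<^bsub>?T\<^esub> B k j) (x, x') = (if l = k then if \<phi> (x', j) = (y, k) then \<one>\<^bsub>R\<^esub> else \<zero>\<^bsub>R\<^esub> else \<zero>\<^bsub>R\<^esub>)" for k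
    proof -
      have "(A i k \<otimes>\<^bsub>?T\<^esub> B k j) (x, x') = (\<Oplus>\<^bsub>R\<^esub>z\<in>{y}. A i k (x, z) \<otimes>\<^bsub>R\<^esub> B k j (z, x'))"
        by (rule translation_mult_entry[OF assms(3) A[OF ij(1)] B[OF ij(2)] x])
          (use x y yl in \<open>auto simp: A_def split: if_splits\<close>)
      then show ?thesis using x y yl by (simp add: A_def B_def)
    qed
    then have "(\<Oplus>\<^bsub>?T\<^esub>k\<in>{..<n}. A i k \<otimes>\<^bsub>?T\<^esub> B k j) (x, x') =
        (\<Oplus>\<^bsub>R\<^esub>k\<in>{..<n}. if l = k then if \<phi> (x', j) = (y, k) then \<one>\<^bsub>R\<^esub> else \<zero>\<^bsub>R\<^esub> else \<zero>\<^bsub>R\<^esub>)"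
      using translation_finsum_entry[OF assms(1-3) _ AB[OF ij] x, of "{..<n}" "\<lambda>k. k"] by simp
    also have "\<dots> = (if \<phi> (x', j) = (y, l) then \<one>\<^bsub>R\<^esub> else \<zero>\<^bsub>R\<^esub>)"
      using yl by (subst R.add.finprod_singleton) auto
    also have "\<phi> (x', j) = (y, l) \<longleftrightarrow> (x', j) = (x, i)"
      using inj_onD[OF inj, of "(x', j)" "(x, i)"] x ij y by auto
    finally show "(\<Oplus>\<^bsub>?T\<^esub>k\<in>{..<n}. A i k \<otimes>\<^bsub>?T\<^esub> B k j) (x, x') = (if i = j then \<one>\<^bsub>?T\<^esub> else \<zero>\<^bsub>?T\<^esub>) (x, x')"
      unfolding translation_delta_entry[OF x] by (simp add: eq_commute)
  qed (simp add: translation_ring_def)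
  then have "identity_factors ?T {..<n + 1} {..<n}"
    unfolding identity_factors_def using A B
    by (intro exI[of _ A] exI[of _ B]) (auto simp: carrier)
  then show ?thesis using not_UGN_iff[OF T.ring_axioms] assms(4) by blast
qed

text \<open>
  Restricting a factorisation over the translation ring to the rows in a Folner set \<open>F\<close> involves only
  the columns in \<open>N = K F \<inter> Y\<close>. It becomes a factorisation over \<open>R\<close> of the identity matrix of size
  \<open>(n + 1) |F|\<close> through \<open>n |N|\<close> dimensions, and \<open>n |N| < (n + 1) |F|\<close>.
\<close>

lemma UGN_translation_if_folner:
  assumes "group G" "Y \<subseteq> carrier G" "ring R" "folner_wrt G Y" "UGN R"
  shows "UGN (translation_ring G Y R)"
proof (rule ccontr)
  interpret G: group G by fact
  interpret R: ring R by fact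
  let ?T = "translation_ring G Y R"
  interpret T: ring ?T by (rule ring_translation_ring) fact+
  have carrier: "carrier ?T = translation_matrices G Y R"
    by (simp add: translation_ring_def)
  assume "\<not> UGN ?T"
  then obtain n :: nat where n: "0 < n" and "identity_factors ?T {..<n + 1} {..<n}"
    using not_UGN_iff[OF T.ring_axioms] by blast
  then obtain A B where
    AB: "\<forall>i\<in>{..<n + 1}. \<forall>k\<in>{..<n}. A i k \<in> carrier ?T \<and> B k i \<in> carrier ?T"
    and id: "\<forall>i\<in>{..<n + 1}. \<forall>j\<in>{..<n + 1}.
      (\<Oplus>\<^bsub>?T\<^esub>k\<in>{..<n}. A i k \<otimes>\<^bsub>?T\<^esub> B k j) = (if i = j then \<one>\<^bsub>?T\<^esub> else \<zero>\<^bsub>?T\<^esub>)"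
    unfolding identity_factors_def by blast
  have A: "A i k \<in> translation_matrices G Y R" if "i < n + 1" "k < n" for i k
    using AB that by (auto simp: carrier)
  have B: "B k i \<in> translation_matrices G Y R" if "i < n + 1" "k < n" for i k
    using AB that by (auto simp: carrier)
  have "\<exists>K. finite K \<and> K \<subseteq> carrier G \<and> (\<forall>x\<in>Y. \<forall>y\<in>Y. y \<notin> K #>\<^bsub>G\<^esub> x \<longrightarrow> A i k (x, y) = \<zero>\<^bsub>R\<^esub>)"
    if "i < n + 1" "k < n" for i k
    using A[OF that] by (simp add: translation_matrices_def)
  then obtain L where L: "\<And>i k. i < n + 1 \<Longrightarrow> k < n \<Longrightarrow> finite (L i k) \<and> L i k \<subseteq> carrier G \<and>
      (\<forall>x\<in>Y. \<forall>y\<in>Y. y \<notin> L i k #>\<^bsub>G\<^esub> x \<longrightarrow> A i k (x, y) = \<zero>\<^bsub>R\<^esub>)"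
    by metis
  \<comment> \<open>The unit is included so that \<open>F \<subseteq> N\<close>, which makes \<open>N\<close> nonempty.\<close>
  define K where "K = insert \<one>\<^bsub>G\<^esub> (\<Union>i<n + 1. \<Union>k<n. L i k)"
  have K: "finite K" "K \<subseteq> carrier G"
    using L by (auto simp: K_def)
  obtain F where F: "finite F" "F \<noteq> {}" "F \<subseteq> Y"
    and small: "n * card ((K <#>\<^bsub>G\<^esub> F) \<inter> Y) < (n + 1) * card F"
    using folner_wrtE[OF assms(4) K n] .
  define N where "N = (K <#>\<^bsub>G\<^esub> F) \<inter> Y"
  have N: "finite N" "N \<subseteq> Y" using K F by (auto simp: N_def finite_set_mult)
  have supp: "{z \<in> Y. A i k (x, z) \<noteq> \<zero>\<^bsub>R\<^esub>} \<subseteq> N" if "i < n + 1" "k < n" "x \<in> F" for i k x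
  proof
    fix z assume z: "z \<in> {z \<in> Y. A i k (x, z) \<noteq> \<zero>\<^bsub>R\<^esub>}"
    then have "z \<in> L i k #>\<^bsub>G\<^esub> x" using L[OF that(1,2)] that(3) F(3) by blast
    then obtain c where c: "c \<in> L i k" "z = c \<otimes>\<^bsub>G\<^esub> x" by (auto simp: r_coset_def)
    have "c \<in> K" using c(1) that(1,2) unfolding K_def by blast
    then show "z \<in> N" using z c(2) that(3) by (auto simp: N_def set_mult_def)
  qed
  have "identity_factors R (F \<times> {..<n + 1}) (N \<times> {..<n})"
    unfolding identity_factors_def
  proof (rule exI[of _ "\<lambda>p q. A (snd p) (snd q) (fst p, fst q)"],
      rule exI[of _ "\<lambda>q p. B (snd q) (snd p) (fst q, fst p)"], intro conjI ballI)
    fix p q assume "p \<in> F \<times> {..<n + 1}" "q \<in> N \<times> {..<n}"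
    then show "A (snd p) (snd q) (fst p, fst q) \<in> carrier R" "B (snd q) (snd p) (fst q, fst p) \<in> carrier R"
      using A B F(3) N(2) by (auto intro!: translation_matrices_entry[where G = G and Y = Y])
  next
    fix p p' assume "p \<in> F \<times> {..<n + 1}" "p' \<in> F \<times> {..<n + 1}"
    moreover obtain x i x' j where p: "p = (x, i)" "p' = (x', j)" by (cases p, cases p')
    ultimately have x: "x \<in> F" "x \<in> Y" "x' \<in> Y" and ij: "i < n + 1" "j < n + 1"
      using F(3) by auto
    have entry: "A i k (x, z) \<otimes>\<^bsub>R\<^esub> B k j (z, x') \<in> carrier R" if "k < n" "z \<in> N" for k z
      using translation_matrices_entry[OF A[OF ij(1) that(1)] x(2), of z]
        translation_matrices_entry[OF B[OF ij(2) that(1)] _ x(3), of z] N(2) that(2) by auto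
    have "(\<Oplus>\<^bsub>R\<^esub>q\<in>N \<times> {..<n}. A i (snd q) (x, fst q) \<otimes>\<^bsub>R\<^esub> B (snd q) j (fst q, x')) =
        (\<Oplus>\<^bsub>R\<^esub>k\<in>{..<n}. \<Oplus>\<^bsub>R\<^esub>z\<in>N. A i k (x, z) \<otimes>\<^bsub>R\<^esub> B k j (z, x'))"
      using finsum_Times[OF R.abelian_monoid_axioms N(1), of "{..<n}"
          "\<lambda>z k. A i k (x, z) \<otimes>\<^bsub>R\<^esub> B k j (z, x')"] entry by simp
    also have "\<dots> = (\<Oplus>\<^bsub>R\<^esub>k\<in>{..<n}. (A i k \<otimes>\<^bsub>?T\<^esub> B k j) (x, x'))"
    proof (rule R.finsum_cong')
      fix k assume "k \<in> {..<n}"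
      then have k: "k < n" by simp
      show "(\<Oplus>\<^bsub>R\<^esub>z\<in>N. A i k (x, z) \<otimes>\<^bsub>R\<^esub> B k j (z, x')) = (A i k \<otimes>\<^bsub>?T\<^esub> B k j) (x, x')"
        by (rule translation_mult_entry[OF assms(3) A[OF ij(1) k] B[OF ij(2) k] x(2,3) N supp[OF ij(1) k x(1)],
              symmetric])
    qed (use A B ij x in \<open>auto intro!: translation_matrices_entry[where G = G and Y = Y] translation_mult_closed assms\<close>)
    also have "\<dots> = (\<Oplus>\<^bsub>?T\<^esub>k\<in>{..<n}. A i k \<otimes>\<^bsub>?T\<^esub> B k j) (x, x')"
      by (rule translation_finsum_entry[OF assms(1-3), symmetric])
        (use A B ij x in \<open>auto intro!: translation_mult_closed assms\<close>)
    also have "\<dots> = (if i = j then \<one>\<^bsub>?T\<^esub> else \<zero>\<^bsub>?T\<^esub>) (x, x')"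
      using id ij by simp
    also have "\<dots> = (if p = p' then \<one>\<^bsub>R\<^esub> else \<zero>\<^bsub>R\<^esub>)"
      unfolding translation_delta_entry[OF x(2,3)] by (simp add: p)
    finally show "(\<Oplus>\<^bsub>R\<^esub>q\<in>N \<times> {..<n}. A (snd p) (snd q) (fst p, fst q) \<otimes>\<^bsub>R\<^esub> B (snd q) (snd p') (fst q, fst p')) =
        (if p = p' then \<one>\<^bsub>R\<^esub> else \<zero>\<^bsub>R\<^esub>)"
      by (simp add: p)
  qed
  moreover have "N \<times> {..<n} \<noteq> {}"
  proof -
    obtain x where x: "x \<in> F" using F(2) by blast
    then have "x = \<one>\<^bsub>G\<^esub> \<otimes>\<^bsub>G\<^esub> x" using F(3) assms(2) by auto
    then have "x \<in> N" using x F(3) by (auto simp: N_def K_def set_mult_def)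
    then show ?thesis using n by auto
  qed
  moreover have "card (N \<times> {..<n}) < card (F \<times> {..<n + 1})"
    using small by (simp add: card_cartesian_product N_def mult.commute)
  moreover have "finite (N \<times> {..<n})" using N(1) by simp
  ultimately have "\<not> UGN R" by (metis not_UGN_if_identity_factors[OF assms(3)])
  then show False using assms(5) by blast
qed

text \<open>
  A surjection from \<open>S\<^sup>n\<close> onto the larger finite set \<open>S\<^bsup>n+1\<^esup>\<close> is impossible.
\<close>

lemma UGN_if_finite:
  assumes "ring S" "finite (carrier S)" "\<one>\<^bsub>S\<^esub> \<noteq> \<zero>\<^bsub>S\<^esub>"
  shows "UGN S"
  unfolding UGN_def
proof (intro allI impI notI, elim exE)
  interpret S: ring S by fact
  fix n f assume f: "f \<in> right_module_epi S (free_right_module S n) (free_right_module S (n + 1))"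
  have card: "card (carrier (free_right_module S m)) = card (carrier S) ^ m" for m
    by (simp add: free_right_module_def card_PiE)
  have "finite (carrier (free_right_module S n))"
    using assms(2) by (simp add: free_right_module_def finite_PiE)
  then have "card (f ` carrier (free_right_module S n)) \<le> card (carrier (free_right_module S n))"
    by (rule card_image_le)
  moreover have "f ` carrier (free_right_module S n) = carrier (free_right_module S (n + 1))"
    using f by (simp add: right_module_epi_def)
  ultimately have "card (carrier S) ^ (n + 1) \<le> card (carrier S) ^ n"
    by (simp only: card)
  moreover have "card {\<zero>\<^bsub>S\<^esub>, \<one>\<^bsub>S\<^esub>} \<le> card (carrier S)"
    using assms(2) by (intro card_mono) auto
  then have "2 \<le> card (carrier S)" using assms(3) by simp
  ultimately show False by simp
qed

text \<open>
  The field with two elements on two given distinct values: \<open>a\<close> is zero and \<open>b\<close> is one.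
\<close>

definition two_element_ring :: "'r \<Rightarrow> 'r \<Rightarrow> 'r ring"
  where "two_element_ring a b =
    \<lparr>carrier = {a, b}, mult = (\<lambda>x y. if x = b \<and> y = b then b else a), one = b, zero = a,
     add = (\<lambda>x y. if x = y then a else b)\<rparr>"

lemma ring_two_element_ring:
  assumes "a \<noteq> b"
  shows "ring (two_element_ring a b)"
proof (rule ringI)
  show "abelian_group (two_element_ring a b)"
    by (rule abelian_groupI) (use assms in \<open>auto simp: two_element_ring_def\<close>)
  show "monoid (two_element_ring a b)"
    by (rule monoidI) (use assms in \<open>auto simp: two_element_ring_def\<close>)
qed (use assms in \<open>auto simp: two_element_ring_def\<close>)

section \<open>Amenable subsets and unbounded generating number\<close>

theorem theoremD:
  fixes G :: "('g, 'm) monoid_scheme" and Y :: "'g set"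
  assumes "group G" and "Y \<subseteq> carrier G"
    and "\<exists>a b :: 'r. a \<noteq> b"
  shows "amenable_wrt G Y \<longleftrightarrow>
    (\<forall>R :: 'r ring. ring R \<longrightarrow> (UGN (translation_ring G Y R) \<longleftrightarrow> UGN R))"
proof
  assume "amenable_wrt G Y"
  then have "folner_wrt G Y"
    using compression_if_not_folner not_amenable_if_compression[OF assms(1,2)] by blast
  then show "\<forall>R :: 'r ring. ring R \<longrightarrow> (UGN (translation_ring G Y R) \<longleftrightarrow> UGN R)"
    using UGN_translation_if_folner[OF assms(1,2)] scalar_matrix_hom[OF assms(1,2)]
      ring_translation_ring[OF assms(1,2)] UGN_ring_hom by blast
next
  assume *: "\<forall>R :: 'r ring. ring R \<longrightarrow> (UGN (translation_ring G Y R) \<longleftrightarrow> UGN R)"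
  show "amenable_wrt G Y"
  proof (rule ccontr)
    assume "\<not> amenable_wrt G Y"
    then have "\<not> folner_wrt G Y" using amenable_if_folner[OF assms(1,2)] by blast
    then obtain K n \<phi> where "0 < n" "compression G Y K n \<phi>"
      using compression_if_not_folner by blast
    then have not_UGN: "\<not> UGN (translation_ring G Y R)" if "ring R" for R :: "'r ring"
      using not_UGN_translation_if_compression[OF assms(1,2) that] by blast
    obtain a b :: 'r where "a \<noteq> b" using assms(3) by blast
    then have "ring (two_element_ring a b)" by (rule ring_two_element_ring)
    moreover from this \<open>a \<noteq> b\<close> have "UGN (two_element_ring a b)"
      by (intro UGN_if_finite) (auto simp: two_element_ring_def)
    ultimately show False using * not_UGN by blast
  qed
qed

end
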